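(* Let $G$ and $G'$ be finite groups with isomorphic (complex) group algebras, let $d_1,\dots,d_r$ be the degrees of the irreducible representations of $G$ (equivalently of $G'$), and let $\hat{\mathcal{A}}=\bigoplus_{i=1}^r\big(I_{d_i}\otimes M_{d_i}(\mathbb{C})\big)$. Suppose that $V$ and $W$ are unitaries satisfying $V^\dagger\Lambda_G V=\hat{\mathcal{A}}=W^\dagger\Lambda_{G'}W$. Let $v^i_{\ell,k}$ and $w^i_{\ell,k}$ denote the columns of $V$ and $W$ indexed by $(i,\ell,k)$, and for $i=1,\dots,r$ define $d_i\times d_i$ matrices $X^i$, $Y^i$ by $X^i_{\ell,k}=(v^i_{\ell,k})^\dagger\mathbf{e}_e$ and $Y^i_{\ell,k}=(w^i_{\ell,k})^\dagger\mathbf{e}_e$. Then a matrix $U$ is a $(G,G')$-transformation matrix if and only if $U=V\hat{U}W^\dagger$ where $$\hat{U}=\widehat{P}^\pi\left(\bigoplus_{i=1}^r M^i\otimes N^i\right)$$ for some $\pi\in\mathrm{Sym}_{\hat{\mathcal{A}}}$ and some $d_i\times d_i$ unitaries $M^i$ and $N^i$ satisfying $M^i=X^{\pi(i)}\,\overline{N^i}\,(Y^i)^{-1}$ for all $i=1,\dots,r$.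
   Context: The left regular representation $\lambda$ of $G$ is given by the $G\times G$ matrices $(\lambda(g))_{x,y}=\delta_{x,gy}$, and $\Lambda_G=\operatorname{span}\{\lambda(g):g\in G\}$; similarly for $G'$. The vector $\mathbf{e}_e$ is the standard basis vector (of $\mathbb{C}^G$ or $\mathbb{C}^{G'}$) indexed by the identity element $e$. The rows of $V$ (resp. $W$) are indexed by $G$ (resp. $G'$). The columns are indexed by triples $(i,\ell,k)$ with $i\in\{1,\dots,r\}$ and $\ell,k\in\{1,\dots,d_i\}$, where $i$ indexes the direct summands of $\hat{\mathcal{A}}$, $\ell$ indexes the first tensor factor and $k$ the second tensor factor. $\overline{N}$ is the entrywise complex conjugate. $\mathrm{Sym}_{\hat{\mathcal{A}}}$ is the group of permutations $\pi$ of $\{1,\dots,r\}$ such that $d_{\pi(i)}=d_i$ for each $i$. For such $\pi$, $\widehat{P}^\pi$ is the $|G|\times|G|$ permutation matrix sending the standard basis vector indexed by $(i,\ell,k)$ to the one indexed by $(\pi(i),\ell,k)$; it satisfies $\widehat{P}^\pi\big(\bigoplus_{i}I_{d_i}\otimes A_i\big)(\widehat{P}^\pi)^\dagger=\bigoplus_{i}I_{d_{\pi^{-1}(i)}}\otimes A_{\pi^{-1}(i)}$ for all $A_i\in M_{d_i}(\mathbb{C})$. A matrix $U\in\mathbb{C}^{G\times G'}$ (rows indexed by $G$, columns by $G'$) is a $(G,G')$-transformation matrix if (1) $U$ is unitary; (2) $\overline{U_{a,b}}=U_{a^{-1},b^{-1}}$ for all $a\in G$, $b\in G'$; and (3) $U_{ab,c}=\sum_{x,y\in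 G',\,xy=c}U_{a,x}U_{b,y}$ for all $a,b\in G$, $c\in G'$. *)

theory Defs
  imports Complex_Main "HOL-Library.Function_Algebras" "HOL-Combinatorics.Permutations"
    "HOL-Algebra.QuotRing" "HOL-Algebra.Module"
begin

section \<open>Matrices with arbitrary finite index sets\<close>

text \<open>
  An \<open>I \<times> J\<close> matrix is a function that vanishes off \<open>I \<times> J\<close>. With this convention, two
  matrices over the same index sets agree iff they are equal as functions, and the
  vectors of \<open>\<complex>\<^sup>I\<close> are the functions that vanish off \<open>I\<close>.
\<close>

type_synonym ('i, 'j) cmatrix = "'i \<Rightarrow> 'j \<Rightarrow> complex"

definition cvecs :: "'i set \<Rightarrow> ('i \<Rightarrow> complex) set" where
  "cvecs I = {v. \<forall>i. i \<notin> I \<longrightarrow> v i = 0}"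

definition cmats :: "'i set \<Rightarrow> 'j set \<Rightarrow> ('i, 'j) cmatrix set" where
  "cmats I J = {A. \<forall>i j. i \<notin> I \<or> j \<notin> J \<longrightarrow> A i j = 0}"

definition cmat_mult :: "('i, 'j) cmatrix \<Rightarrow> 'j set \<Rightarrow> ('j, 'k) cmatrix \<Rightarrow> ('i, 'k) cmatrix"
    ("(_ \<cdot>\<^bsub>_\<^esub> _)" [71, 0, 70] 70) where
  "A \<cdot>\<^bsub>J\<^esub> B = (\<lambda>i k. \<Sum>j\<in>J. A i j * B j k)"

definition cmat_vec :: "('i, 'j) cmatrix \<Rightarrow> 'j set \<Rightarrow> ('j \<Rightarrow> complex) \<Rightarrow> 'i \<Rightarrow> complex" where
  "cmat_vec A J v = (\<lambda>i. \<Sum>j\<in>J. A i j * v j)"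

definition cmat_one :: "'i set \<Rightarrow> ('i, 'i) cmatrix" where
  "cmat_one I = (\<lambda>i j. if i \<in> I \<and> i = j then 1 else 0)"

definition dagger :: "('i, 'j) cmatrix \<Rightarrow> ('j, 'i) cmatrix" where
  "dagger A = (\<lambda>j i. cnj (A i j))"

definition conj_mat :: "('i, 'j) cmatrix \<Rightarrow> ('i, 'j) cmatrix" where
  "conj_mat A = (\<lambda>i j. cnj (A i j))"

definition unitary_mat :: "'i set \<Rightarrow> 'j set \<Rightarrow> ('i, 'j) cmatrix \<Rightarrow> bool" where
  "unitary_mat I J A \<longleftrightarrow> A \<in> cmats I J \<and>
     A \<cdot>\<^bsub>J\<^esub> dagger A = cmat_one I \<and> dagger A \<cdot>\<^bsub>I\<^esub> A = cmat_one J"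

definition basis_vec :: "'i \<Rightarrow> 'i \<Rightarrow> complex" where
  "basis_vec a = (\<lambda>i. if i = a then 1 else 0)"

definition cinner :: "'i set \<Rightarrow> ('i \<Rightarrow> complex) \<Rightarrow> ('i \<Rightarrow> complex) \<Rightarrow> complex" where
  "cinner I v w = (\<Sum>i\<in>I. cnj (v i) * w i)"

definition vec_scale :: "complex \<Rightarrow> ('i \<Rightarrow> complex) \<Rightarrow> 'i \<Rightarrow> complex" where
  "vec_scale c v = (\<lambda>i. c * v i)"

definition mat_scale :: "complex \<Rightarrow> ('i, 'j) cmatrix \<Rightarrow> ('i, 'j) cmatrix" where
  "mat_scale c A = (\<lambda>i j. c * A i j)"

lemma vector_space_vec_scale: "vector_space vec_scale"
  by unfold_locales (auto simp: vec_scale_def fun_eq_iff algebra_simps)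

lemma vector_space_mat_scale: "vector_space mat_scale"
  by unfold_locales (auto simp: mat_scale_def fun_eq_iff algebra_simps)

text \<open>
  The monoid of square matrices indexed by \<open>I\<close>: its \<^const>\<open>Units\<close> are the invertible
  matrices, \<^const>\<open>m_inv\<close> is the matrix inverse, and \<^const>\<open>units_of\<close> yields the general
  linear group.
\<close>

definition mat_monoid :: "'i set \<Rightarrow> ('i, 'i) cmatrix monoid" where
  "mat_monoid I = \<lparr>carrier = cmats I I, mult = (\<lambda>A B. A \<cdot>\<^bsub>I\<^esub> B), one = cmat_one I\<rparr>"


section \<open>Group algebras\<close>

definition group_algebra ::
    "('a, 'm) monoid_scheme \<Rightarrow> (complex, 'a \<Rightarrow> complex) module" where
  "group_algebra G = \<lparr>carrier = cvecs (carrier G),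
     mult = (\<lambda>f h x. \<Sum>(y, z) | y \<in> carrier G \<and> z \<in> carrier G \<and> y \<otimes>\<^bsub>G\<^esub> z = x. f y * h z),
     one = basis_vec \<one>\<^bsub>G\<^esub>,
     zero = (\<lambda>x. 0),
     add = (\<lambda>f h x. f x + h x),
     smult = vec_scale\<rparr>"

definition algebra_isomorphic ::
    "(complex, 'a, 'm) module_scheme \<Rightarrow> (complex, 'b, 'n) module_scheme \<Rightarrow> bool" where
  "algebra_isomorphic A B \<longleftrightarrow> (\<exists>\<phi>\<in>ring_iso A B.
     \<forall>c. \<forall>x\<in>carrier A. \<phi> (c \<odot>\<^bsub>A\<^esub> x) = c \<odot>\<^bsub>B\<^esub> \<phi> x)"

definition left_regular :: "('a, 'm) monoid_scheme \<Rightarrow> 'a \<Rightarrow> ('a, 'a) cmatrix" where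
  "left_regular G g = (\<lambda>x y. if x \<in> carrier G \<and> y \<in> carrier G \<and> x = g \<otimes>\<^bsub>G\<^esub> y then 1 else 0)"

definition regular_algebra :: "('a, 'm) monoid_scheme \<Rightarrow> ('a, 'a) cmatrix set" where
  "regular_algebra G = module.span mat_scale (left_regular G ` carrier G)"


section \<open>Irreducible representations and their degrees\<close>

definition representation ::
    "('a, 'm) monoid_scheme \<Rightarrow> nat \<Rightarrow> ('a \<Rightarrow> (nat, nat) cmatrix) \<Rightarrow> bool" where
  "representation G n \<rho> \<longleftrightarrow> \<rho> \<in> hom G (units_of (mat_monoid {1..n}))"

definition irreducible_rep ::
    "('a, 'm) monoid_scheme \<Rightarrow> nat \<Rightarrow> ('a \<Rightarrow> (nat, nat) cmatrix) \<Rightarrow> bool" where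
  "irreducible_rep G n \<rho> \<longleftrightarrow> representation G n \<rho> \<and> 1 \<le> n \<and>
     (\<forall>S. S \<subseteq> cvecs {1..n} \<and> module.subspace vec_scale S \<and>
          (\<forall>g\<in>carrier G. \<forall>v\<in>S. cmat_vec (\<rho> g) {1..n} v \<in> S)
        \<longrightarrow> S = {0} \<or> S = cvecs {1..n})"

definition equivalent_reps ::
    "('a, 'm) monoid_scheme \<Rightarrow> nat \<Rightarrow> ('a \<Rightarrow> (nat, nat) cmatrix) \<Rightarrow>
       nat \<Rightarrow> ('a \<Rightarrow> (nat, nat) cmatrix) \<Rightarrow> bool" where
  "equivalent_reps G m \<rho> n \<sigma> \<longleftrightarrow> m = n \<and>
     (\<exists>P\<in>Units (mat_monoid {1..n}). \<forall>g\<in>carrier G. P \<cdot>\<^bsub>{1..n}\<^esub> \<rho> g = \<sigma> g \<cdot>\<^bsub>{1..n}\<^esub> P)"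

text \<open>
  \<open>d 1, \<dots>, d r\<close> lists the degrees of the irreducible representations, one entry for each
  equivalence class.
\<close>

definition irrep_degrees :: "('a, 'm) monoid_scheme \<Rightarrow> nat \<Rightarrow> (nat \<Rightarrow> nat) \<Rightarrow> bool" where
  "irrep_degrees G r d \<longleftrightarrow> (\<exists>\<rho>.
     (\<forall>i\<in>{1..r}. irreducible_rep G (d i) (\<rho> i)) \<and>
     (\<forall>i\<in>{1..r}. \<forall>j\<in>{1..r}. i \<noteq> j \<longrightarrow> \<not> equivalent_reps G (d i) (\<rho> i) (d j) (\<rho> j)) \<and>
     (\<forall>n \<sigma>. irreducible_rep G n \<sigma> \<longrightarrow>
        (\<exists>i\<in>{1..r}. equivalent_reps G n \<sigma> (d i) (\<rho> i))))"


section \<open>Block matrices indexed by triples\<close>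

text \<open>
  In a triple \<open>(i, l, k)\<close>, \<open>i\<close> selects the direct summand, \<open>l\<close> the first and \<open>k\<close> the second
  tensor factor.
\<close>

type_synonym triple = "nat \<times> nat \<times> nat"

definition triples :: "nat \<Rightarrow> (nat \<Rightarrow> nat) \<Rightarrow> triple set" where
  "triples r d = (SIGMA i:{1..r}. {1..d i} \<times> {1..d i})"

definition kron ::
    "('i, 'j) cmatrix \<Rightarrow> ('k, 'l) cmatrix \<Rightarrow> ('i \<times> 'k, 'j \<times> 'l) cmatrix" where
  "kron A B = (\<lambda>(i, k) (j, l). A i j * B k l)"

definition direct_sum :: "nat \<Rightarrow> (nat \<Rightarrow> ('i, 'j) cmatrix) \<Rightarrow> (nat \<times> 'i, nat \<times> 'j) cmatrix" where
  "direct_sum r B = (\<lambda>(i, p) (j, q). if i \<in> {1..r} \<and> i = j then B i p q else 0)"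

definition A_hat :: "nat \<Rightarrow> (nat \<Rightarrow> nat) \<Rightarrow> (triple, triple) cmatrix set" where
  "A_hat r d = {direct_sum r (\<lambda>i. kron (cmat_one {1..d i}) (A i)) |A.
     \<forall>i\<in>{1..r}. A i \<in> cmats {1..d i} {1..d i}}"

definition Sym_A_hat :: "nat \<Rightarrow> (nat \<Rightarrow> nat) \<Rightarrow> (nat \<Rightarrow> nat) set" where
  "Sym_A_hat r d = {\<pi>. \<pi> permutes {1..r} \<and> (\<forall>i\<in>{1..r}. d (\<pi> i) = d i)}"

definition P_hat :: "nat \<Rightarrow> (nat \<Rightarrow> nat) \<Rightarrow> (nat \<Rightarrow> nat) \<Rightarrow> (triple, triple) cmatrix" where
  "P_hat r d \<pi> = (\<lambda>s (i, l, k). if (i, l, k) \<in> triples r d \<and> s = (\<pi> i, l, k) then 1 else 0)"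

text \<open>The matrix of the numbers \<open>(v\<^sup>i\<^bsub>l,k\<^esub>)\<^sup>\<dagger> e\<close>, where \<open>v\<^sup>i\<^bsub>l,k\<^esub>\<close> is a column of \<open>V\<close>.\<close>

definition unit_coeffs ::
    "('a, 'm) monoid_scheme \<Rightarrow> ('a, triple) cmatrix \<Rightarrow> nat \<Rightarrow> (nat, nat) cmatrix" where
  "unit_coeffs G V i =
     (\<lambda>l k. cinner (carrier G) (\<lambda>x. V x (i, l, k)) (basis_vec \<one>\<^bsub>G\<^esub>))"


section \<open>Transformation matrices\<close>

definition transformation_matrix ::
    "('a, 'm) monoid_scheme \<Rightarrow> ('b, 'n) monoid_scheme \<Rightarrow> ('a, 'b) cmatrix \<Rightarrow> bool" where
  "transformation_matrix G G' U \<longleftrightarrow>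
     unitary_mat (carrier G) (carrier G') U \<and>
     (\<forall>a\<in>carrier G. \<forall>b\<in>carrier G'. cnj (U a b) = U (inv\<^bsub>G\<^esub> a) (inv\<^bsub>G'\<^esub> b)) \<and>
     (\<forall>a\<in>carrier G. \<forall>b\<in>carrier G. \<forall>c\<in>carrier G'.
        U (a \<otimes>\<^bsub>G\<^esub> b) c =
          (\<Sum>(x, y) | x \<in> carrier G' \<and> y \<in> carrier G' \<and> x \<otimes>\<^bsub>G'\<^esub> y = c. U a x * U b y))"

end

theory Submission
  imports Defs
begin

text \<open>
  If \<open>U\<close> is a transformation matrix and \<open>L\<close> is left convolution by \<open>f\<close>, then \<open>U\<^sup>\<dagger> L U\<close> is left
  convolution by \<open>U\<^sup>\<dagger> f\<close>. From this one sees that a unitary \<open>U\<close> is a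
  transformation matrix iff it fixes the identity vector \<open>e\<close> and conjugates one regular
  algebra onto the other. In the bases \<open>V\<close> and \<open>W\<close> this says that \<open>Q = V\<^sup>\<dagger> U W\<close> normalises the
  block algebra and sends \<open>W\<^sup>\<dagger> e\<close> to \<open>V\<^sup>\<dagger> e\<close>. Conjugation by a normalising unitary also preserves
  the commutant, and a rank-one matrix unit is the product of a matrix unit of the algebra with one
  of the commutant; so outer products of columns of \<open>Q\<close> are block sums of tensor products, which
  forces \<open>Q = P\<^sup>\<pi> (\<Oplus>\<^sub>i M\<^sup>i \<otimes> N\<^sup>i)\<close>. Reading \<open>W\<^sup>\<dagger> e\<close> and \<open>V\<^sup>\<dagger> e\<close> as block matrices \<open>Y\<close> and \<open>X\<close>,
  the vector condition becomes \<open>M\<^sup>i Y\<^sup>i (N\<^sup>i)\<^sup>T = X\<^bsup>\<pi>(i)\<^esup>\<close>.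
\<close>


section \<open>Matrix calculus\<close>

lemma cmats_outside: "A \<in> cmats I J \<Longrightarrow> i \<notin> I \<or> j \<notin> J \<Longrightarrow> A i j = 0"
  by (auto simp: cmats_def)

lemma cmats_eqI:
  assumes "A \<in> cmats I J" "B \<in> cmats I J" "\<And>i j. i \<in> I \<Longrightarrow> j \<in> J \<Longrightarrow> A i j = B i j"
  shows "A = B"
proof (intro ext)
  fix i j show "A i j = B i j"
    using assms by (cases "i \<in> I \<and> j \<in> J") (auto simp: cmats_def)
qed

lemma cmat_mult_assoc: "(A \<cdot>\<^bsub>J\<^esub> B) \<cdot>\<^bsub>K\<^esub> C = A \<cdot>\<^bsub>J\<^esub> (B \<cdot>\<^bsub>K\<^esub> C)"
proof (intro ext)
  fix i l
  have "((A \<cdot>\<^bsub>J\<^esub> B) \<cdot>\<^bsub>K\<^esub> C) i l = (\<Sum>k\<in>K. \<Sum>j\<in>J. A i j * (B j k * C k l))"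
    by (simp add: cmat_mult_def sum_distrib_right mult.assoc)
  also have "\<dots> = (\<Sum>j\<in>J. \<Sum>k\<in>K. A i j * (B j k * C k l))"
    by (rule sum.swap)
  also have "\<dots> = (A \<cdot>\<^bsub>J\<^esub> (B \<cdot>\<^bsub>K\<^esub> C)) i l"
    by (simp add: cmat_mult_def sum_distrib_left)
  finally show "((A \<cdot>\<^bsub>J\<^esub> B) \<cdot>\<^bsub>K\<^esub> C) i l = (A \<cdot>\<^bsub>J\<^esub> (B \<cdot>\<^bsub>K\<^esub> C)) i l" .
qed

lemma cmat_vec_mult: "cmat_vec (A \<cdot>\<^bsub>J\<^esub> B) K v = cmat_vec A J (cmat_vec B K v)"
proof (intro ext)
  fix i
  have "cmat_vec (A \<cdot>\<^bsub>J\<^esub> B) K v i = (\<Sum>k\<in>K. \<Sum>j\<in>J. A i j * (B j k * v k))"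
    by (simp add: cmat_vec_def cmat_mult_def sum_distrib_right mult.assoc)
  also have "\<dots> = (\<Sum>j\<in>J. \<Sum>k\<in>K. A i j * (B j k * v k))"
    by (rule sum.swap)
  also have "\<dots> = cmat_vec A J (cmat_vec B K v) i"
    by (simp add: cmat_vec_def sum_distrib_left)
  finally show "cmat_vec (A \<cdot>\<^bsub>J\<^esub> B) K v i = cmat_vec A J (cmat_vec B K v) i" .
qed

lemma cmat_mult_in: "A \<in> cmats I J \<Longrightarrow> B \<in> cmats J K \<Longrightarrow> A \<cdot>\<^bsub>J\<^esub> B \<in> cmats I K"
  by (auto simp: cmats_def cmat_mult_def)

lemma cmat_one_in: "cmat_one I \<in> cmats I I"
  by (auto simp: cmats_def cmat_one_def)

lemma dagger_in: "A \<in> cmats I J \<Longrightarrow> dagger A \<in> cmats J I"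
  by (auto simp: cmats_def dagger_def)

lemma cmat_vec_in: "A \<in> cmats I J \<Longrightarrow> cmat_vec A J v \<in> cvecs I"
  by (auto simp: cmats_def cvecs_def cmat_vec_def)

lemma dagger_dagger [simp]: "dagger (dagger A) = A"
  by (simp add: dagger_def)

lemma dagger_mult: "dagger (A \<cdot>\<^bsub>J\<^esub> B) = dagger B \<cdot>\<^bsub>J\<^esub> dagger A"
  by (simp add: dagger_def cmat_mult_def fun_eq_iff mult.commute)

lemma dagger_one [simp]: "dagger (cmat_one I) = cmat_one I"
  by (auto simp: dagger_def cmat_one_def fun_eq_iff)

lemma cmat_one_mult:
  assumes "finite I" "A \<in> cmats I J"
  shows "cmat_one I \<cdot>\<^bsub>I\<^esub> A = A"
proof (intro ext)
  fix i k
  have "(cmat_one I \<cdot>\<^bsub>I\<^esub> A) i k = (\<Sum>j\<in>I. if j = i then A i k else 0)"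
    unfolding cmat_mult_def cmat_one_def by (rule sum.cong) auto
  then show "(cmat_one I \<cdot>\<^bsub>I\<^esub> A) i k = A i k"
    using assms by (auto simp: cmats_def)
qed

lemma cmat_mult_one: "finite J \<Longrightarrow> A \<in> cmats I J \<Longrightarrow> A \<cdot>\<^bsub>J\<^esub> cmat_one J = A"
  by (auto simp: cmat_mult_def cmat_one_def cmats_def fun_eq_iff if_distrib [of "\<lambda>x. _ * x"]
      cong: if_cong conj_cong)

lemma cmat_vec_one:
  assumes "finite I" "v \<in> cvecs I"
  shows "cmat_vec (cmat_one I) I v = v"
proof
  fix i
  have "cmat_vec (cmat_one I) I v i = (\<Sum>j\<in>I. if j = i then v i else 0)"
    unfolding cmat_vec_def cmat_one_def by (rule sum.cong) auto
  then show "cmat_vec (cmat_one I) I v i = v i"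
    using assms by (auto simp: cvecs_def)
qed

lemma cmat_vec_basis: "finite J \<Longrightarrow> b \<in> J \<Longrightarrow> cmat_vec A J (basis_vec b) = (\<lambda>i. A i b)"
  by (simp add: cmat_vec_def basis_vec_def if_distrib [of "\<lambda>x. _ * x"] cong: if_cong)

lemma basis_vec_in: "a \<in> I \<Longrightarrow> basis_vec a \<in> cvecs I"
  by (auto simp: basis_vec_def cvecs_def)

lemma unitary_matD:
  assumes "unitary_mat I J A"
  shows "A \<in> cmats I J" "A \<cdot>\<^bsub>J\<^esub> dagger A = cmat_one I" "dagger A \<cdot>\<^bsub>I\<^esub> A = cmat_one J"
  using assms by (auto simp: unitary_mat_def)

lemma unitary_dagger: "unitary_mat I J A \<Longrightarrow> unitary_mat J I (dagger A)"
  by (auto simp: unitary_mat_def dagger_in)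

lemma unitary_mult:
  assumes "finite I" "finite J" "finite K" "unitary_mat I J A" "unitary_mat J K B"
  shows "unitary_mat I K (A \<cdot>\<^bsub>J\<^esub> B)"
proof -
  note A = unitary_matD [OF assms(4)] and B = unitary_matD [OF assms(5)]
  have "(A \<cdot>\<^bsub>J\<^esub> B) \<cdot>\<^bsub>K\<^esub> dagger (A \<cdot>\<^bsub>J\<^esub> B) = A \<cdot>\<^bsub>J\<^esub> ((B \<cdot>\<^bsub>K\<^esub> dagger B) \<cdot>\<^bsub>J\<^esub> dagger A)"
    by (simp add: dagger_mult cmat_mult_assoc)
  moreover have "dagger (A \<cdot>\<^bsub>J\<^esub> B) \<cdot>\<^bsub>I\<^esub> (A \<cdot>\<^bsub>J\<^esub> B) = dagger B \<cdot>\<^bsub>J\<^esub> ((dagger A \<cdot>\<^bsub>I\<^esub> A) \<cdot>\<^bsub>J\<^esub> B)"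
    by (simp add: dagger_mult cmat_mult_assoc)
  ultimately show ?thesis
    using A B assms(1-3) dagger_in [OF A(1)]
    by (simp add: unitary_mat_def cmat_mult_in cmat_one_mult dagger_in)
qed

lemma unitary_conj_mat: "unitary_mat I J A \<Longrightarrow> unitary_mat I J (conj_mat A)"
proof -
  assume A: "unitary_mat I J A"
  have "conj_mat A \<cdot>\<^bsub>J\<^esub> dagger (conj_mat A) = conj_mat (A \<cdot>\<^bsub>J\<^esub> dagger A)"
    "dagger (conj_mat A) \<cdot>\<^bsub>I\<^esub> conj_mat A = conj_mat (dagger A \<cdot>\<^bsub>I\<^esub> A)"
    by (auto simp: conj_mat_def cmat_mult_def dagger_def fun_eq_iff)
  moreover have "conj_mat (cmat_one K) = cmat_one K" for K :: "'c set"
    by (auto simp: conj_mat_def cmat_one_def fun_eq_iff)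
  moreover have "conj_mat (cmat_one K) = cmat_one K" for K :: "'d set"
    by (auto simp: conj_mat_def cmat_one_def fun_eq_iff)
  ultimately show ?thesis
    using A by (auto simp: unitary_mat_def cmats_def conj_mat_def)
qed

lemma unitary_row_norm:
  assumes "unitary_mat I J A" "i \<in> I"
  shows "(\<Sum>j\<in>J. (cmod (A i j))\<^sup>2) = 1"
proof -
  have "complex_of_real (\<Sum>j\<in>J. (cmod (A i j))\<^sup>2) = (A \<cdot>\<^bsub>J\<^esub> dagger A) i i"
    by (simp only: of_real_sum complex_norm_square) (simp add: cmat_mult_def dagger_def)
  also have "\<dots> = 1"
    using assms by (simp add: unitary_mat_def cmat_one_def)
  finally show ?thesis
    by (metis of_real_eq_1_iff)
qed

text \<open>The squared moduli of all entries, summed by rows and then by columns, count both index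
  sets. This later forces matched blocks to have equal size.\<close>

lemma unitary_card_eq:
  assumes "finite I" "finite J" "unitary_mat I J A"
  shows "card I = card J"
proof -
  have "real (card I) = (\<Sum>i\<in>I. \<Sum>j\<in>J. (cmod (A i j))\<^sup>2)"
    using unitary_row_norm [OF assms(3)] by simp
  also have "\<dots> = (\<Sum>j\<in>J. \<Sum>i\<in>I. (cmod (dagger A j i))\<^sup>2)"
    by (subst sum.swap) (simp add: dagger_def)
  also have "\<dots> = real (card J)"
    using unitary_row_norm [OF unitary_dagger [OF assms(3)]] by simp
  finally show ?thesis by simp
qed

lemma monoid_mat_monoid: "finite I \<Longrightarrow> monoid (mat_monoid I)"
  by unfold_locales
    (auto simp: mat_monoid_def cmat_mult_in cmat_one_in cmat_mult_assoc cmat_one_mult cmat_mult_one)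

section \<open>Conjugation by rectangular unitaries\<close>

definition conj_by :: "'i set \<Rightarrow> ('i, 'j) cmatrix \<Rightarrow> ('i, 'i) cmatrix \<Rightarrow> ('j, 'j) cmatrix" where
  "conj_by I Q L = dagger Q \<cdot>\<^bsub>I\<^esub> (L \<cdot>\<^bsub>I\<^esub> Q)"

lemma conj_by_conj_by: "conj_by J R (conj_by I Q L) = conj_by I (Q \<cdot>\<^bsub>J\<^esub> R) L"
  by (simp add: conj_by_def dagger_mult cmat_mult_assoc)

lemma conj_by_in: "Q \<in> cmats I J \<Longrightarrow> L \<in> cmats I I \<Longrightarrow> conj_by I Q L \<in> cmats J J"
  by (simp add: conj_by_def cmat_mult_in dagger_in)

lemma conj_by_one: "finite I \<Longrightarrow> L \<in> cmats I I \<Longrightarrow> conj_by I (cmat_one I) L = L"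
  by (simp add: conj_by_def cmat_one_mult cmat_mult_one)

lemma conj_by_mult:
  assumes "finite I" "unitary_mat I J Q" "L \<in> cmats I I" "K \<in> cmats I I"
  shows "conj_by I Q (L \<cdot>\<^bsub>I\<^esub> K) = conj_by I Q L \<cdot>\<^bsub>J\<^esub> conj_by I Q K"
proof -
  note Q = unitary_matD [OF assms(2)]
  have "conj_by I Q L \<cdot>\<^bsub>J\<^esub> conj_by I Q K = dagger Q \<cdot>\<^bsub>I\<^esub> L \<cdot>\<^bsub>I\<^esub> (Q \<cdot>\<^bsub>J\<^esub> dagger Q) \<cdot>\<^bsub>I\<^esub> K \<cdot>\<^bsub>I\<^esub> Q"
    by (simp add: conj_by_def cmat_mult_assoc)
  also have "\<dots> = conj_by I Q (L \<cdot>\<^bsub>I\<^esub> K)"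
    using Q assms
    by (simp add: conj_by_def cmat_mult_assoc cmat_one_mult [OF assms(1) cmat_mult_in])
  finally show ?thesis ..
qed

text \<open>\<open>Q Q\<^sup>\<dagger> = 1\<close> makes conjugation by \<open>dagger Q\<close> undo
  conjugation by \<open>Q\<close> on \<open>S\<close>, so an image equation can be read
  backwards.\<close>

lemma conj_by_dagger_image:
  assumes "finite I" "unitary_mat I J Q" "S \<subseteq> cmats I I" "conj_by I Q ` S = S'"
  shows "conj_by J (dagger Q) ` S' = S"
proof -
  have "conj_by J (dagger Q) (conj_by I Q L) = L" if "L \<in> S" for L
    using that assms unitary_matD(2) [OF assms(2)] by (auto simp: conj_by_conj_by conj_by_one)
  then show ?thesis
    using assms(4) by (force simp: image_iff)
qed


section \<open>The regular algebra\<close>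

text \<open>The matrix of left convolution by \<open>f\<close>, that is, the sum of the
  \<open>left_regular G g\<close> weighted by \<open>f g\<close>. It parametrises the span by
  vectors.\<close>

definition reg :: "('a, 'm) monoid_scheme \<Rightarrow> ('a \<Rightarrow> complex) \<Rightarrow> ('a, 'a) cmatrix" where
  "reg G f = (\<lambda>x y. if x \<in> carrier G \<and> y \<in> carrier G then f (x \<otimes>\<^bsub>G\<^esub> inv\<^bsub>G\<^esub> y) else 0)"

lemma reg_in: "reg G f \<in> cmats (carrier G) (carrier G)"
  by (auto simp: reg_def cmats_def)

lemma sum_fun_apply2: "(\<Sum>a\<in>A. F a) x y = (\<Sum>a\<in>A. F a x y)"
  for F :: "'a \<Rightarrow> 'b \<Rightarrow> 'c \<Rightarrow> complex"
  by (induction A rule: infinite_finite_induct) auto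

text \<open>The convolution matrices form a subspace containing the generators; conversely each is
  the combination of generators with coefficients \<open>f g\<close>.\<close>

lemma (in group) regular_algebra_eq:
  assumes fin: "finite (carrier G)"
  shows "regular_algebra G = reg G ` cvecs (carrier G)"
proof
  interpret M: vector_space "mat_scale :: complex \<Rightarrow> ('a, 'a) cmatrix \<Rightarrow> _"
    by (rule vector_space_mat_scale)
  have sub: "M.subspace (reg G ` cvecs (carrier G))"
    unfolding M.subspace_def
  proof (intro conjI ballI allI)
    have "0 = reg G 0" by (auto simp: reg_def fun_eq_iff)
    moreover have "0 \<in> cvecs (carrier G)" by (auto simp: cvecs_def)
    ultimately show "0 \<in> reg G ` cvecs (carrier G)" by blast
  next
    fix A B assume "A \<in> reg G ` cvecs (carrier G)" "B \<in> reg G ` cvecs (carrier G)"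
    then obtain f h where "A = reg G f" "B = reg G h" "f \<in> cvecs (carrier G)" "h \<in> cvecs (carrier G)"
      by auto
    then have "A + B = reg G (f + h)" "f + h \<in> cvecs (carrier G)"
      by (auto simp: reg_def fun_eq_iff cvecs_def)
    then show "A + B \<in> reg G ` cvecs (carrier G)" by blast
  next
    fix c A assume "A \<in> reg G ` cvecs (carrier G)"
    then obtain f where "A = reg G f" "f \<in> cvecs (carrier G)" by auto
    then have "mat_scale c A = reg G (vec_scale c f)" "vec_scale c f \<in> cvecs (carrier G)"
      by (auto simp: reg_def fun_eq_iff cvecs_def mat_scale_def vec_scale_def)
    then show "mat_scale c A \<in> reg G ` cvecs (carrier G)" by blast
  qed
  have unit: "left_regular G g = reg G (basis_vec g)" if "g \<in> carrier G" for g
  proof (intro ext)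
    fix x y
    show "left_regular G g x y = reg G (basis_vec g) x y"
      using that by (auto simp: left_regular_def reg_def basis_vec_def m_assoc)
  qed
  have "left_regular G ` carrier G \<subseteq> reg G ` cvecs (carrier G)"
    using unit basis_vec_in by fastforce
  then show "regular_algebra G \<subseteq> reg G ` cvecs (carrier G)"
    unfolding regular_algebra_def using sub by (rule M.span_minimal)
  show "reg G ` cvecs (carrier G) \<subseteq> regular_algebra G"
  proof clarify
    fix f :: "'a \<Rightarrow> complex"
    have "reg G f = (\<Sum>g\<in>carrier G. mat_scale (f g) (left_regular G g))"
    proof (intro ext)
      fix x y
      \<comment> \<open>At a fixed entry only one group element contributes.\<close>
      have *: "mat_scale (f g) (left_regular G g) x y =
          (if g = x \<otimes> inv y then reg G f x y else 0)" if "g \<in> carrier G" for g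
        using that unit [of g] by (auto simp: mat_scale_def reg_def basis_vec_def)
      show "reg G f x y = (\<Sum>g\<in>carrier G. mat_scale (f g) (left_regular G g)) x y"
        using fin by (auto simp: sum_fun_apply2 * cong: sum.cong) (auto simp: reg_def)
    qed
    also have "\<dots> \<in> regular_algebra G"
      unfolding regular_algebra_def by (intro M.span_sum M.span_scale M.span_base) auto
    finally show "reg G f \<in> regular_algebra G" .
  qed
qed

text \<open>The identity column of a convolution matrix is \<open>f\<close>, so an element of the
  regular algebra is recovered from its action on the identity vector.\<close>

lemma (in group) reg_vec_one:
  assumes "finite (carrier G)" "f \<in> cvecs (carrier G)"
  shows "cmat_vec (reg G f) (carrier G) (basis_vec \<one>) = f"
  using assms by (auto simp: cmat_vec_basis reg_def cvecs_def fun_eq_iff)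

lemma (in group) reg_basis_one: "reg G (basis_vec \<one>) = cmat_one (carrier G)"
proof (intro ext)
  fix x y
  show "reg G (basis_vec \<one>) x y = cmat_one (carrier G) x y"
    using inv_equality [of x "inv y"]
    by (auto simp: reg_def basis_vec_def cmat_one_def)
qed

text \<open>A factorisation of \<open>c\<close> is determined by its second factor; this makes the
  pair sum in the third condition a sum over one element.\<close>

lemma (in group) sum_factorisations:
  assumes "finite (carrier G)" "c \<in> carrier G"
  shows "(\<Sum>(x, y) | x \<in> carrier G \<and> y \<in> carrier G \<and> x \<otimes> y = c. (F x y :: complex)) =
    (\<Sum>y\<in>carrier G. F (c \<otimes> inv y) y)"
  using assms
  by (intro sum.reindex_bij_witness [of _ "\<lambda>y. (c \<otimes> inv y, y)" snd])
    (auto simp: m_assoc)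

section \<open>Transformation matrices as intertwiners of regular algebras\<close>

lemma transformation_matrix_intertwines:
  assumes G: "group G" "finite (carrier G)" and G': "group G'" "finite (carrier G')"
    and U: "transformation_matrix G G' U" and f: "f \<in> cvecs (carrier G)"
  shows "reg G f \<cdot>\<^bsub>carrier G\<^esub> U =
    U \<cdot>\<^bsub>carrier G'\<^esub> reg G' (cmat_vec (dagger U) (carrier G) f)"
proof -
  interpret G: group G by fact
  interpret H: group G' by fact
  have Uin: "U \<in> cmats (carrier G) (carrier G')"
    using U by (auto simp: transformation_matrix_def unitary_mat_def)
  have U2: "cnj (U a b) = U (inv\<^bsub>G\<^esub> a) (inv\<^bsub>G'\<^esub> b)" if "a \<in> carrier G" "b \<in> carrier G'" for a b
    using U that by (auto simp: transformation_matrix_def)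
  have U3: "U (a \<otimes>\<^bsub>G\<^esub> b) c = (\<Sum>z\<in>carrier G'. U a (c \<otimes>\<^bsub>G'\<^esub> inv\<^bsub>G'\<^esub> z) * U b z)"
    if "a \<in> carrier G" "b \<in> carrier G" "c \<in> carrier G'" for a b c
    using U that H.sum_factorisations [OF G'(2) that(3), of "\<lambda>x y. U a x * U b y"]
    by (auto simp: transformation_matrix_def)
  show ?thesis
  proof (rule cmats_eqI)
    show "reg G f \<cdot>\<^bsub>carrier G\<^esub> U \<in> cmats (carrier G) (carrier G')"
      "U \<cdot>\<^bsub>carrier G'\<^esub> reg G' (cmat_vec (dagger U) (carrier G) f) \<in> cmats (carrier G) (carrier G')"
      using Uin reg_in cmat_mult_in by blast+
    fix x c assume x: "x \<in> carrier G" and c: "c \<in> carrier G'"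
    \<comment> \<open>The second condition turns the conjugates in \<open>dagger U\<close> into
      entries at inverses. The third then collapses the sum over \<open>z\<close> to
      \<open>U\<close> at the inverse of \<open>a\<close> times \<open>x\<close>, and substituting
      that product for \<open>b\<close> gives a convolution.\<close>
    have "(U \<cdot>\<^bsub>carrier G'\<^esub> reg G' (cmat_vec (dagger U) (carrier G) f)) x c =
        (\<Sum>z\<in>carrier G'. \<Sum>a\<in>carrier G. f a * (U (inv\<^bsub>G\<^esub> a) (c \<otimes>\<^bsub>G'\<^esub> inv\<^bsub>G'\<^esub> z) * U x z))"
      using c by (auto simp: cmat_mult_def reg_def cmat_vec_def dagger_def sum_distrib_left U2
          H.inv_mult_group intro!: sum.cong)
    also have "\<dots> = (\<Sum>a\<in>carrier G. f a * U (inv\<^bsub>G\<^esub> a \<otimes>\<^bsub>G\<^esub> x) c)"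
      using x c by (subst sum.swap) (simp add: U3 sum_distrib_left)
    also have "\<dots> = (\<Sum>b\<in>carrier G. f (x \<otimes>\<^bsub>G\<^esub> inv\<^bsub>G\<^esub> b) * U b c)"
      using x by (intro sum.reindex_bij_witness [of _ "\<lambda>b. x \<otimes>\<^bsub>G\<^esub> inv\<^bsub>G\<^esub> b" "\<lambda>a. inv\<^bsub>G\<^esub> a \<otimes>\<^bsub>G\<^esub> x"])
        (auto simp: G.inv_mult_group G.m_assoc, (simp add: G.m_assoc [symmetric])+)
    also have "\<dots> = (reg G f \<cdot>\<^bsub>carrier G\<^esub> U) x c"
      using x by (auto simp: cmat_mult_def reg_def intro!: sum.cong)
    finally show "(reg G f \<cdot>\<^bsub>carrier G\<^esub> U) x c =
        (U \<cdot>\<^bsub>carrier G'\<^esub> reg G' (cmat_vec (dagger U) (carrier G) f)) x c" ..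
  qed
qed

text \<open>Multiplying the intertwining relation by \<open>dagger U\<close> shows that conjugation
  sends convolution by \<open>f\<close> to convolution by \<open>dagger U\<close> applied to
  \<open>f\<close>. Since \<open>dagger U\<close> is onto, so is the induced map of
  algebras.\<close>

lemma transformation_matrixD:
  assumes G: "group G" "finite (carrier G)" and G': "group G'" "finite (carrier G')"
    and U: "transformation_matrix G G' U"
  shows "cmat_vec U (carrier G') (basis_vec \<one>\<^bsub>G'\<^esub>) = basis_vec \<one>\<^bsub>G\<^esub>"
    and "conj_by (carrier G) U ` regular_algebra G = regular_algebra G'"
proof -
  interpret G: group G by fact
  interpret H: group G' by fact
  have un: "unitary_mat (carrier G) (carrier G') U"
    using U by (auto simp: transformation_matrix_def)
  note U' = unitary_matD [OF un]
  have tw: "conj_by (carrier G) U (reg G f) = reg G' (cmat_vec (dagger U) (carrier G) f)"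
    if "f \<in> cvecs (carrier G)" for f
  proof -
    have "conj_by (carrier G) U (reg G f) = (dagger U \<cdot>\<^bsub>carrier G\<^esub> U) \<cdot>\<^bsub>carrier G'\<^esub>
        reg G' (cmat_vec (dagger U) (carrier G) f)"
      by (simp add: conj_by_def transformation_matrix_intertwines [OF G G' U that] cmat_mult_assoc)
    then show ?thesis
      using U' by (simp add: cmat_one_mult [OF G'(2) reg_in])
  qed
  \<comment> \<open>Convolution by the identity vector is the identity matrix, which conjugation
    preserves; its identity column then reveals the image of the identity vector.\<close>
  have "reg G' (cmat_vec (dagger U) (carrier G) (basis_vec \<one>\<^bsub>G\<^esub>)) = cmat_one (carrier G')"
    using tw [OF basis_vec_in [OF G.one_closed]] U' G
    by (simp add: G.reg_basis_one conj_by_def cmat_one_mult)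
  then have "cmat_vec (dagger U) (carrier G) (basis_vec \<one>\<^bsub>G\<^esub>) = basis_vec \<one>\<^bsub>G'\<^esub>"
    by (metis G'(2) H.one_closed H.reg_vec_one U'(1) basis_vec_in cmat_vec_in cmat_vec_one dagger_in)
  then show "cmat_vec U (carrier G') (basis_vec \<one>\<^bsub>G'\<^esub>) = basis_vec \<one>\<^bsub>G\<^esub>"
    by (metis G(2) G.one_closed U'(2) basis_vec_in cmat_vec_one cmat_vec_mult)
  have surj: "cmat_vec (dagger U) (carrier G) ` cvecs (carrier G) = cvecs (carrier G')"
  proof
    show "cmat_vec (dagger U) (carrier G) ` cvecs (carrier G) \<subseteq> cvecs (carrier G')"
      using U'(1) cmat_vec_in dagger_in by blast
    have "f = cmat_vec (dagger U) (carrier G) (cmat_vec U (carrier G') f)"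
      if "f \<in> cvecs (carrier G')" for f
      using that U' G' by (simp add: cmat_vec_mult [symmetric] cmat_vec_one)
    then show "cvecs (carrier G') \<subseteq> cmat_vec (dagger U) (carrier G) ` cvecs (carrier G)"
      using cmat_vec_in [OF U'(1)] by blast
  qed
  show "conj_by (carrier G) U ` regular_algebra G = regular_algebra G'"
    using tw by (auto simp: G.regular_algebra_eq [OF G(2)] H.regular_algebra_eq [OF G'(2)]
        surj [symmetric] image_image)
qed

text \<open>The conjugate of \<open>left_regular G a\<close> is convolution by some
  \<open>h\<close>, and the fixed identity vector forces \<open>h\<close> to be the conjugated row
  \<open>a\<close> of \<open>U\<close>. Comparing entries yields a shift formula that contains both
  remaining conditions.\<close>

lemma transformation_matrixI:
  assumes G: "group G" "finite (carrier G)" and G': "group G'" "finite (carrier G')"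
    and un: "unitary_mat (carrier G) (carrier G') U"
    and one: "cmat_vec U (carrier G') (basis_vec \<one>\<^bsub>G'\<^esub>) = basis_vec \<one>\<^bsub>G\<^esub>"
    and alg: "conj_by (carrier G) U ` regular_algebra G \<subseteq> regular_algebra G'"
  shows "transformation_matrix G G' U"
proof -
  interpret G: group G by fact
  interpret H: group G' by fact
  note U' = unitary_matD [OF un]
  have one': "cmat_vec (dagger U) (carrier G) (basis_vec \<one>\<^bsub>G\<^esub>) = basis_vec \<one>\<^bsub>G'\<^esub>"
    using one U' G'(2)
    by (metis H.one_closed basis_vec_in cmat_vec_one cmat_vec_mult)
  have U1: "U \<one>\<^bsub>G\<^esub> z = (if z = \<one>\<^bsub>G'\<^esub> then 1 else 0)" for z
    using fun_cong [OF one', of z] G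
    by (auto simp: cmat_vec_basis dagger_def basis_vec_def [of "\<one>\<^bsub>G'\<^esub>"] split: if_splits)
  have shift: "U (inv\<^bsub>G\<^esub> a \<otimes>\<^bsub>G\<^esub> x) c =
      (\<Sum>z\<in>carrier G'. U x z * cnj (U a (z \<otimes>\<^bsub>G'\<^esub> inv\<^bsub>G'\<^esub> c)))"
    if a: "a \<in> carrier G" and x: "x \<in> carrier G" and c: "c \<in> carrier G'" for a x c
  proof -
    have "conj_by (carrier G) U (reg G (basis_vec a)) \<in> regular_algebra G'"
      using a alg basis_vec_in by (fastforce simp: G.regular_algebra_eq [OF G(2)])
    then obtain h where h: "h \<in> cvecs (carrier G')"
      and eq: "conj_by (carrier G) U (reg G (basis_vec a)) = reg G' h"
      by (auto simp: H.regular_algebra_eq [OF G'(2)])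
    \<comment> \<open>Evaluation at the identity vector of \<open>G'\<close>, which \<open>U\<close>
      carries to that of \<open>G\<close>, determines \<open>h\<close>.\<close>
    have "h = cmat_vec (conj_by (carrier G) U (reg G (basis_vec a))) (carrier G') (basis_vec \<one>\<^bsub>G'\<^esub>)"
      using h G' by (simp add: eq H.reg_vec_one)
    also have "\<dots> = cmat_vec (dagger U) (carrier G) (basis_vec a)"
      using a G by (simp add: conj_by_def cmat_vec_mult one G.reg_vec_one basis_vec_in)
    finally have h': "h = (\<lambda>z. cnj (U a z))"
      using a G by (simp add: cmat_vec_basis dagger_def)
    \<comment> \<open>Inserting \<open>U U\<^sup>\<dagger> = 1\<close> in front makes the conjugate
      of \<open>reg G (basis_vec a)\<close> appear.\<close>
    have "reg G (basis_vec a) \<cdot>\<^bsub>carrier G\<^esub> U = (U \<cdot>\<^bsub>carrier G'\<^esub> dagger U) \<cdot>\<^bsub>carrier G\<^esub>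
        (reg G (basis_vec a) \<cdot>\<^bsub>carrier G\<^esub> U)"
      using U' G(2) by (simp add: cmat_one_mult [OF _ cmat_mult_in [OF reg_in]])
    also have "\<dots> = U \<cdot>\<^bsub>carrier G'\<^esub> reg G' h"
      by (simp add: cmat_mult_assoc conj_by_def eq [symmetric])
    finally have "(reg G (basis_vec a) \<cdot>\<^bsub>carrier G\<^esub> U) x c = (U \<cdot>\<^bsub>carrier G'\<^esub> reg G' h) x c"
      by simp
    moreover have "(reg G (basis_vec a) \<cdot>\<^bsub>carrier G\<^esub> U) x c =
        (\<Sum>b\<in>carrier G. if b = inv\<^bsub>G\<^esub> a \<otimes>\<^bsub>G\<^esub> x then U b c else 0)"
      unfolding cmat_mult_def
    proof (rule sum.cong)
      fix b assume b: "b \<in> carrier G"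
      have "x \<otimes>\<^bsub>G\<^esub> inv\<^bsub>G\<^esub> b = a \<longleftrightarrow> b = inv\<^bsub>G\<^esub> a \<otimes>\<^bsub>G\<^esub> x"
        using a b x by (metis G.inv_closed G.inv_solve_left G.inv_solve_right)
      then show "reg G (basis_vec a) x b * U b c =
          (if b = inv\<^bsub>G\<^esub> a \<otimes>\<^bsub>G\<^esub> x then U b c else 0)"
        using b x by (simp add: reg_def basis_vec_def)
    qed simp
    ultimately show ?thesis
      using a x c G by (simp add: cmat_mult_def reg_def h' cong: sum.cong)
  qed
  \<comment> \<open>Taking \<open>x\<close> to be the identity leaves only the summand at the
    identity of \<open>G'\<close>, by \<open>U1\<close>.\<close>
  have U2: "U (inv\<^bsub>G\<^esub> a) c = cnj (U a (inv\<^bsub>G'\<^esub> c))" if "a \<in> carrier G" "c \<in> carrier G'" for a c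
    using shift [OF that(1) G.one_closed that(2)] that G'
    by (simp add: U1 if_distrib [of "\<lambda>x. x * _"] cong: if_cong)
  \<comment> \<open>The shift formula for the inverse of \<open>a\<close>; its conjugate is removed
    by \<open>U2\<close>.\<close>
  have U3: "U (a \<otimes>\<^bsub>G\<^esub> b) c = (\<Sum>z\<in>carrier G'. U a (c \<otimes>\<^bsub>G'\<^esub> inv\<^bsub>G'\<^esub> z) * U b z)"
    if "a \<in> carrier G" "b \<in> carrier G" "c \<in> carrier G'" for a b c
    using shift [of "inv\<^bsub>G\<^esub> a" b c] that
    by (simp add: U2 H.inv_mult_group mult.commute cong: sum.cong)
  show ?thesis
    unfolding transformation_matrix_def
    using un U2 U3 H.sum_factorisations [OF G'(2)] by simp
qed


section \<open>Block permutation matrices\<close>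

declare One_nat_def [simp del]

lemma finite_triples [simp]: "finite (triples r d)"
  by (simp add: triples_def)

lemma mem_triples: "(i, l, k) \<in> triples r d \<longleftrightarrow> i \<in> {1..r} \<and> l \<in> {1..d i} \<and> k \<in> {1..d i}"
  by (simp add: triples_def)

lemma sum_triples:
  "(\<Sum>t\<in>triples r d. (f t :: complex)) = (\<Sum>i\<in>{1..r}. \<Sum>l\<in>{1..d i}. \<Sum>k\<in>{1..d i}. f (i, l, k))"
  by (simp add: triples_def sum.Sigma sum.cartesian_product)

text \<open>The matrix \<open>P\<^sup>\<pi> (\<Oplus>\<^sub>i M\<^sup>i \<otimes> N\<^sup>i)\<close>.\<close>

definition block_perm ::
    "nat \<Rightarrow> (nat \<Rightarrow> nat) \<Rightarrow> (nat \<Rightarrow> (nat, nat) cmatrix) \<Rightarrow> (nat \<Rightarrow> (nat, nat) cmatrix) \<Rightarrow>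
       (triple, triple) cmatrix" where
  "block_perm r \<pi> M N = (\<lambda>(p, l, k) (i, l', k').
     if i \<in> {1..r} \<and> p = \<pi> i then M i l l' * N i k k' else 0)"

lemma block_perm_apply:
  "block_perm r \<pi> M N (p, l, k) (i, l', k') =
     (if i \<in> {1..r} \<and> p = \<pi> i then M i l l' * N i k k' else 0)"
  by (simp add: block_perm_def)

definition block_mats :: "nat \<Rightarrow> (nat \<Rightarrow> nat) \<Rightarrow> (nat \<Rightarrow> (nat, nat) cmatrix) set" where
  "block_mats r d = {M. \<forall>i\<in>{1..r}. M i \<in> cmats {1..d i} {1..d i}}"

lemma Sym_A_hatD:
  assumes "\<pi> \<in> Sym_A_hat r d"
  shows "\<pi> permutes {1..r}" "i \<in> {1..r} \<Longrightarrow> \<pi> i \<in> {1..r}" "i \<in> {1..r} \<Longrightarrow> d (\<pi> i) = d i"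
  using assms by (auto simp: Sym_A_hat_def permutes_in_image simp del: atLeastAtMost_iff)

lemma id_in_Sym_A_hat: "id \<in> Sym_A_hat r d"
  by (simp add: Sym_A_hat_def permutes_id)

text \<open>HOL-Algebra reserves the notation \<open>inv\<close> for group inverses.\<close>

abbreviation inv_perm :: "(nat \<Rightarrow> nat) \<Rightarrow> nat \<Rightarrow> nat" where
  "inv_perm \<equiv> inv_into UNIV"

lemma inv_in_Sym_A_hat:
  assumes "\<pi> \<in> Sym_A_hat r d"
  shows "inv_perm \<pi> \<in> Sym_A_hat r d"
proof -
  have p: "inv_perm \<pi> permutes {1..r}"
    using assms by (simp add: Sym_A_hat_def permutes_inv)
  have "d (inv_perm \<pi> i) = d i" if "i \<in> {1..r}" for i
    using that Sym_A_hatD(3) [OF assms, of "inv_perm \<pi> i"] permutes_in_image [OF p]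
      permutes_inverses(1) [OF Sym_A_hatD(1) [OF assms], of i] by simp
  with p show ?thesis by (simp add: Sym_A_hat_def)
qed

lemma block_perm_cong:
  assumes "\<And>i. i \<in> {1..r} \<Longrightarrow> \<pi> i = \<pi>' i" "\<And>i. i \<in> {1..r} \<Longrightarrow> M i = M' i"
    "\<And>i. i \<in> {1..r} \<Longrightarrow> N i = N' i"
  shows "block_perm r \<pi> M N = block_perm r \<pi>' M' N'"
  using assms by (auto simp: block_perm_def fun_eq_iff)

lemma block_perm_in:
  assumes "\<pi> \<in> Sym_A_hat r d" "M \<in> block_mats r d" "N \<in> block_mats r d"
  shows "block_perm r \<pi> M N \<in> cmats (triples r d) (triples r d)"
proof -
  have "block_perm r \<pi> M N (p, l, k) (i, l', k') = 0"
    if "(p, l, k) \<notin> triples r d \<or> (i, l', k') \<notin> triples r d" for p l k i l' k'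
  proof (cases "i \<in> {1..r} \<and> p = \<pi> i")
    case True
    then have "M i \<in> cmats {1..d i} {1..d i}" "N i \<in> cmats {1..d i} {1..d i}"
      "p \<in> {1..r}" "d p = d i"
      using assms Sym_A_hatD [OF assms(1)] by (auto simp: block_mats_def)
    with True that show ?thesis
      unfolding mem_triples block_perm_apply using cmats_outside by fastforce
  qed (auto simp: block_perm_apply)
  then show ?thesis
    by (auto simp: cmats_def)
qed

text \<open>The right factor sends column block \<open>i\<close> to row block
  \<open>\<pi>' i\<close>, so the left factor contributes its data at \<open>\<pi>' i\<close>. The
  two inner sums then separate along the tensor factors; \<open>d (\<pi>' i) = d i\<close> fixes
  their range.\<close>

lemma block_perm_mult:
  assumes "\<pi>' \<in> Sym_A_hat r d"
  shows "block_perm r \<pi> M N \<cdot>\<^bsub>triples r d\<^esub> block_perm r \<pi>' M' N' =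
    block_perm r (\<pi> \<circ> \<pi>') (\<lambda>i. M (\<pi>' i) \<cdot>\<^bsub>{1..d i}\<^esub> M' i) (\<lambda>i. N (\<pi>' i) \<cdot>\<^bsub>{1..d i}\<^esub> N' i)"
proof -
  have "(block_perm r \<pi> M N \<cdot>\<^bsub>triples r d\<^esub> block_perm r \<pi>' M' N') (p, l, k) (i, l', k') =
      block_perm r (\<pi> \<circ> \<pi>') (\<lambda>i. M (\<pi>' i) \<cdot>\<^bsub>{1..d i}\<^esub> M' i) (\<lambda>i. N (\<pi>' i) \<cdot>\<^bsub>{1..d i}\<^esub> N' i)
        (p, l, k) (i, l', k')" for p l k i l' k'
  proof (cases "i \<in> {1..r}")
    case i: True
    define q where "q = \<pi>' i"
    have q: "q \<in> {1..r}" "d q = d i"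
      using Sym_A_hatD [OF assms] i by (auto simp: q_def)
    have "(block_perm r \<pi> M N \<cdot>\<^bsub>triples r d\<^esub> block_perm r \<pi>' M' N') (p, l, k) (i, l', k') =
        (\<Sum>j\<in>{1..r}. if j = q then \<Sum>a\<in>{1..d i}. \<Sum>b\<in>{1..d i}.
          (if p = \<pi> q then (M q l a * N q k b) * (M' i a l' * N' i b k') else 0) else 0)"
      unfolding cmat_mult_def sum_triples
      using i q by (intro sum.cong) (auto simp: block_perm_apply q_def [symmetric] intro!: sum.cong)
    also have "\<dots> = (if p = \<pi> q then \<Sum>a\<in>{1..d i}. \<Sum>b\<in>{1..d i}.
          (M q l a * M' i a l') * (N q k b * N' i b k') else 0)"
      using q by (auto intro!: sum.cong simp: mult_ac)
    also have "\<dots> = (if p = \<pi> q then (M q \<cdot>\<^bsub>{1..d i}\<^esub> M' i) l l' * (N q \<cdot>\<^bsub>{1..d i}\<^esub> N' i) k k' else 0)"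
      by (simp add: cmat_mult_def sum_product)
    finally show ?thesis
      using i by (simp add: block_perm_apply q_def)
  next
    case False
    then show ?thesis
      by (auto simp: cmat_mult_def block_perm_apply intro!: sum.neutral split: prod.splits)
  qed
  then show ?thesis by (auto simp: fun_eq_iff)
qed

text \<open>The adjoint exchanges source and target blocks, so its source block \<open>i\<close>
  carries the data that \<open>\<pi>\<close> had moved to \<open>i\<close>.\<close>

lemma block_perm_dagger:
  assumes "\<pi> \<in> Sym_A_hat r d"
  shows "dagger (block_perm r \<pi> M N) =
    block_perm r (inv_perm \<pi>) (\<lambda>i. dagger (M (inv_perm \<pi> i))) (\<lambda>i. dagger (N (inv_perm \<pi> i)))"
proof -
  note p = Sym_A_hatD(1) [OF assms]
  have "(p \<in> {1..r} \<and> i = \<pi> p) \<longleftrightarrow> (i \<in> {1..r} \<and> p = inv_perm \<pi> i)" for p i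
    using permutes_in_image [OF p, of p] permutes_inverses [OF p] by metis
  then have "dagger (block_perm r \<pi> M N) (p, l, k) (i, l', k') =
      block_perm r (inv_perm \<pi>) (\<lambda>i. dagger (M (inv_perm \<pi> i))) (\<lambda>i. dagger (N (inv_perm \<pi> i))) (p, l, k) (i, l', k')"
    for p l k i l' k'
    by (simp add: dagger_def block_perm_apply del: atLeastAtMost_iff)
  then show ?thesis by (auto simp: fun_eq_iff)
qed

lemma block_perm_one:
  "block_perm r id (\<lambda>i. cmat_one {1..d i}) (\<lambda>i. cmat_one {1..d i}) = cmat_one (triples r d)"
  by (auto simp: block_perm_def cmat_one_def mem_triples fun_eq_iff)

text \<open>Direct sums, \<open>P_hat\<close> and the elements of \<open>A_hat\<close> all become
  instances of \<open>block_perm\<close>, so a single product rule governs them.\<close>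

lemma direct_sum_kron: "direct_sum r (\<lambda>i. kron (M i) (N i)) = block_perm r id M N"
  by (auto simp: direct_sum_def kron_def block_perm_def fun_eq_iff)

lemma P_hat_eq:
  "P_hat r d \<pi> = block_perm r \<pi> (\<lambda>i. cmat_one {1..d i}) (\<lambda>i. cmat_one {1..d i})"
  by (auto simp: P_hat_def cmat_one_def mem_triples block_perm_def fun_eq_iff)

lemma A_hat_eq: "A_hat r d = block_perm r id (\<lambda>i. cmat_one {1..d i}) ` block_mats r d"
  unfolding A_hat_def direct_sum_kron block_mats_def by blast

lemma one_in_block_mats: "(\<lambda>i. cmat_one {1..d i}) \<in> block_mats r d"
  by (simp add: block_mats_def cmat_one_in)

lemma A_hat_in: "A_hat r d \<subseteq> cmats (triples r d) (triples r d)"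
  by (auto simp: A_hat_eq block_perm_in id_in_Sym_A_hat one_in_block_mats)

lemma P_hat_mult_direct_sum:
  assumes "M \<in> block_mats r d" "N \<in> block_mats r d"
  shows "P_hat r d \<pi> \<cdot>\<^bsub>triples r d\<^esub> direct_sum r (\<lambda>i. kron (M i) (N i)) = block_perm r \<pi> M N"
  unfolding P_hat_eq direct_sum_kron
  by (subst block_perm_mult [OF id_in_Sym_A_hat], rule block_perm_cong)
    (use assms in \<open>auto simp: block_mats_def cmat_one_mult simp del: atLeastAtMost_iff\<close>)

lemma unitary_block_perm:
  assumes p: "\<pi> \<in> Sym_A_hat r d"
    and M: "\<And>i. i \<in> {1..r} \<Longrightarrow> unitary_mat {1..d i} {1..d i} (M i)"
    and N: "\<And>i. i \<in> {1..r} \<Longrightarrow> unitary_mat {1..d i} {1..d i} (N i)"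
  shows "unitary_mat (triples r d) (triples r d) (block_perm r \<pi> M N)"
proof -
  note inv = permutes_inverses [OF Sym_A_hatD(1) [OF p]]
  note p' = inv_in_Sym_A_hat [OF p]
  have d: "d (inv_perm \<pi> i) = d i" "inv_perm \<pi> i \<in> {1..r}" if "i \<in> {1..r}" for i
    using Sym_A_hatD(2,3) [OF p'] that by auto
  have "M \<in> block_mats r d" "N \<in> block_mats r d"
    using M N by (auto simp: block_mats_def unitary_mat_def)
  note in_cm = block_perm_in [OF p this]
  have "block_perm r \<pi> M N \<cdot>\<^bsub>triples r d\<^esub> dagger (block_perm r \<pi> M N) = cmat_one (triples r d)"
    unfolding block_perm_dagger [OF p] block_perm_mult [OF p'] block_perm_one [symmetric]
  proof (rule block_perm_cong)
    fix i assume i: "i \<in> {1..r}"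
    show "M (inv_perm \<pi> i) \<cdot>\<^bsub>{1..d i}\<^esub> dagger (M (inv_perm \<pi> i)) = cmat_one {1..d i}"
      using unitary_matD(2) [OF M [OF d(2) [OF i]]] by (simp only: d(1) [OF i])
    show "N (inv_perm \<pi> i) \<cdot>\<^bsub>{1..d i}\<^esub> dagger (N (inv_perm \<pi> i)) = cmat_one {1..d i}"
      using unitary_matD(2) [OF N [OF d(2) [OF i]]] by (simp only: d(1) [OF i])
  qed (simp add: inv)
  moreover have "dagger (block_perm r \<pi> M N) \<cdot>\<^bsub>triples r d\<^esub> block_perm r \<pi> M N = cmat_one (triples r d)"
    unfolding block_perm_dagger [OF p] block_perm_mult [OF p] block_perm_one [symmetric]
    by (rule block_perm_cong) (simp_all only: inv o_apply id_apply unitary_matD(3) [OF M] unitary_matD(3) [OF N])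
  ultimately show ?thesis
    using in_cm by (simp add: unitary_mat_def)
qed

text \<open>The algebra is the identity on first tensor factors, where unitarity of
  \<open>M i\<close> gives cancellation. On second factors \<open>N i\<close> conjugates the
  component at \<open>\<pi> i\<close>.\<close>

lemma conj_by_block_perm:
  assumes p: "\<pi> \<in> Sym_A_hat r d"
    and M: "\<And>i. i \<in> {1..r} \<Longrightarrow> unitary_mat {1..d i} {1..d i} (M i)"
    and N: "\<And>i. i \<in> {1..r} \<Longrightarrow> unitary_mat {1..d i} {1..d i} (N i)"
  shows "conj_by (triples r d) (block_perm r \<pi> M N) ` A_hat r d \<subseteq> A_hat r d"
proof clarify
  fix L assume "L \<in> A_hat r d"
  then obtain A where A: "A \<in> block_mats r d" and L: "L = block_perm r id (\<lambda>i. cmat_one {1..d i}) A"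
    by (auto simp: A_hat_eq)
  note inv = permutes_inverses [OF Sym_A_hatD(1) [OF p]]
  define B where "B = (\<lambda>i. dagger (N i) \<cdot>\<^bsub>{1..d i}\<^esub> (A (\<pi> i) \<cdot>\<^bsub>{1..d i}\<^esub> N i))"
  have "conj_by (triples r d) (block_perm r \<pi> M N) L = block_perm r id (\<lambda>i. cmat_one {1..d i}) B"
    unfolding conj_by_def L block_perm_mult [OF p] block_perm_dagger [OF p] id_comp
  proof (rule block_perm_cong)
    fix i assume i: "i \<in> {1..r}"
    then show "dagger (M (inv_perm \<pi> (\<pi> i))) \<cdot>\<^bsub>{1..d i}\<^esub> (cmat_one {1..d (\<pi> i)} \<cdot>\<^bsub>{1..d i}\<^esub> M i) = cmat_one {1..d i}"
      using unitary_matD [OF M [OF i]] inv Sym_A_hatD(3) [OF p i] by (simp add: cmat_one_mult)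
  qed (auto simp: inv B_def)
  moreover have "B \<in> block_mats r d"
    unfolding block_mats_def
  proof clarify
    fix i assume i: "i \<in> {1..r}"
    have "A (\<pi> i) \<in> cmats {1..d (\<pi> i)} {1..d (\<pi> i)}"
      using A Sym_A_hatD(2) [OF p i] by (simp add: block_mats_def)
    then have "A (\<pi> i) \<in> cmats {1..d i} {1..d i}"
      by (simp only: Sym_A_hatD(3) [OF p i])
    then show "B i \<in> cmats {1..d i} {1..d i}"
      unfolding B_def using unitary_matD(1) [OF N [OF i]] by (intro cmat_mult_in dagger_in)
  qed
  ultimately show "conj_by (triples r d) (block_perm r \<pi> M N) L \<in> A_hat r d"
    by (auto simp: A_hat_eq)
qed

text \<open>A vector on triples is read as a family of matrices, on which a tensor product acts by
  \<open>Z \<mapsto> M Z N\<^sup>T\<close>. The transpose is written as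
  \<open>dagger (conj_mat _)\<close>.\<close>

lemma block_perm_vec:
  assumes p: "\<pi> \<in> Sym_A_hat r d" and i: "i \<in> {1..r}"
  shows "cmat_vec (block_perm r \<pi> M N) (triples r d) (\<lambda>(j, a, b). Z j a b) (\<pi> i, l, k) =
    (M i \<cdot>\<^bsub>{1..d i}\<^esub> (Z i \<cdot>\<^bsub>{1..d i}\<^esub> dagger (conj_mat (N i)))) l k"
proof -
  have inj: "\<pi> i = \<pi> j \<longleftrightarrow> i = j" for j
    using permutes_inj [OF Sym_A_hatD(1) [OF p]] by (auto dest: injD)
  have "cmat_vec (block_perm r \<pi> M N) (triples r d) (\<lambda>(j, a, b). Z j a b) (\<pi> i, l, k) =
      (\<Sum>j\<in>{1..r}. if j = i then \<Sum>a\<in>{1..d i}. \<Sum>b\<in>{1..d i}. M i l a * N i k b * Z i a b else 0)"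
    unfolding cmat_vec_def sum_triples by (intro sum.cong) (auto simp: block_perm_apply inj)
  then show ?thesis
    using i by (simp add: cmat_mult_def dagger_def conj_mat_def sum_distrib_left mult_ac)
qed


section \<open>The normaliser of the block algebra\<close>

text \<open>A matrix unit in summand \<open>i\<close>, zero in the others. In the second tensor slot
  it gives an element of the algebra, in the first one of its commutant.\<close>

definition single_block :: "nat \<Rightarrow> nat \<Rightarrow> nat \<Rightarrow> nat \<Rightarrow> (nat, nat) cmatrix" where
  "single_block i a b = (\<lambda>j k k'. if j = i \<and> k = a \<and> k' = b then 1 else 0)"

lemma single_block_in:
  "a \<in> {1..d i} \<Longrightarrow> b \<in> {1..d i} \<Longrightarrow> single_block i a b \<in> block_mats r d"
  by (auto simp: single_block_def block_mats_def cmats_def)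

text \<open>Commuting with the matrix units of the algebra kills all entries with different summands
  or different second indices, and makes the rest independent of the second index.\<close>

lemma commutant_A_hat:
  assumes d: "\<And>i. i \<in> {1..r} \<Longrightarrow> 1 \<le> d i"
    and C: "C \<in> cmats (triples r d) (triples r d)"
    and comm: "\<And>A. A \<in> A_hat r d \<Longrightarrow> C \<cdot>\<^bsub>triples r d\<^esub> A = A \<cdot>\<^bsub>triples r d\<^esub> C"
  shows "\<exists>M\<in>block_mats r d. C = block_perm r id M (\<lambda>i. cmat_one {1..d i})"
proof -
  \<comment> \<open>With \<open>E\<close> the matrix unit in the second slot, each of the two
    products has at most one summand per entry.\<close>
  have key: "(if q = i \<and> k' = b then C (p, l, k) (i, l', a) else 0) =
      (if p = i \<and> k = a then C (i, l, b) (q, l', k') else 0)"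
    if T: "(p, l, k) \<in> triples r d" "(q, l', k') \<in> triples r d"
      and i: "i \<in> {1..r}" "a \<in> {1..d i}" "b \<in> {1..d i}" for p l k q l' k' i a b
  proof -
    define E where "E = block_perm r id (\<lambda>i. cmat_one {1..d i}) (single_block i a b)"
    have E: "E (j, x, y) (j', x', y') =
        (if j = i \<and> j' = i \<and> x = x' \<and> x \<in> {1..d i} \<and> y = a \<and> y' = b then 1 else 0)" for j x y j' x' y'
      using i by (auto simp: E_def block_perm_apply cmat_one_def single_block_def)
    have "E \<in> A_hat r d"
      unfolding E_def A_hat_eq using i by (intro imageI single_block_in)
    from comm [OF this] have "(C \<cdot>\<^bsub>triples r d\<^esub> E) (p, l, k) (q, l', k') =
        (E \<cdot>\<^bsub>triples r d\<^esub> C) (p, l, k) (q, l', k')" by simp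
    moreover have "(C \<cdot>\<^bsub>triples r d\<^esub> E) (p, l, k) (q, l', k') = (\<Sum>s\<in>triples r d.
        if s = (i, l', a) then (if q = i \<and> k' = b then C (p, l, k) (i, l', a) else 0) else 0)"
      unfolding cmat_mult_def by (intro sum.cong) (use T in \<open>auto simp: E mem_triples split: if_splits\<close>)
    moreover have "(E \<cdot>\<^bsub>triples r d\<^esub> C) (p, l, k) (q, l', k') = (\<Sum>s\<in>triples r d.
        if s = (i, l, b) then (if p = i \<and> k = a then C (i, l, b) (q, l', k') else 0) else 0)"
      unfolding cmat_mult_def by (intro sum.cong) (use T in \<open>auto simp: E mem_triples split: if_splits\<close>)
    ultimately show ?thesis
      using T i by (auto simp: mem_triples split: if_splits)
  qed
  \<comment> \<open>The second index 1 serves as reference; it exists in every summand because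
    \<open>1 \<le> d i\<close>.\<close>
  define M where "M = (\<lambda>i l l'. if (i, l, 1) \<in> triples r d \<and> (i, l', 1) \<in> triples r d
    then C (i, l, 1) (i, l', 1) else 0)"
  have M: "M \<in> block_mats r d"
    by (auto simp: M_def block_mats_def cmats_def mem_triples)
  have "C = block_perm r id M (\<lambda>i. cmat_one {1..d i})"
  proof (rule cmats_eqI [OF C block_perm_in [OF id_in_Sym_A_hat M one_in_block_mats]])
    fix s t assume st: "s \<in> triples r d" "t \<in> triples r d"
    obtain p l k q l' k' where s: "s = (p, l, k)" and t: "t = (q, l', k')"
      by (metis prod.collapse)
    have q: "q \<in> {1..r}" "k' \<in> {1..d q}" "1 \<in> {1..d q}"
      using st t d by (auto simp: mem_triples)
    \<comment> \<open>The diagonal unit at \<open>k'\<close> isolates the support.\<close>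
    have "C s t = (if p = q \<and> k = k' then C s t else 0)"
      using key [OF st [unfolded s t] q(1) q(2) q(2)] by (auto simp: s t)
    moreover have "C s t = M q l l'" if eq: "p = q" "k = k'"
    proof -
      have T: "(q, l, 1) \<in> triples r d" "(q, l', 1) \<in> triples r d"
        using st q eq by (auto simp: s t mem_triples)
      \<comment> \<open>The unit with row 1 and column \<open>k'\<close> moves the second index to
        the reference value.\<close>
      from key [OF T(1) st(2) [unfolded t] q(1) q(3) q(2)] T eq show ?thesis
        by (simp add: s t M_def)
    qed
    ultimately show "C s t = block_perm r id M (\<lambda>i. cmat_one {1..d i}) s t"
      using q by (simp add: s t block_perm_apply cmat_one_def)
  qed
  with M show ?thesis by blast
qed


text \<open>Conjugation by \<open>dagger Q\<close> is multiplicative and maps the algebra onto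
  itself, so it preserves the commutant too. It has the form \<open>Q L Q\<^sup>\<dagger>\<close>,
  in which columns of \<open>Q\<close> become visible.\<close>

lemma normaliser_matrix_units:
  assumes d: "\<And>i. i \<in> {1..r} \<Longrightarrow> 1 \<le> d i"
    and Q: "unitary_mat (triples r d) (triples r d) Q"
    and img: "conj_by (triples r d) Q ` A_hat r d = A_hat r d"
    and ab: "a \<in> {1..d i}" "b \<in> {1..d i}"
  shows "\<exists>C\<in>block_mats r d.
      conj_by (triples r d) (dagger Q) (block_perm r id (single_block i a b) (\<lambda>i. cmat_one {1..d i})) =
      block_perm r id C (\<lambda>i. cmat_one {1..d i})"
    and "\<exists>D\<in>block_mats r d.
      conj_by (triples r d) (dagger Q) (block_perm r id (\<lambda>i. cmat_one {1..d i}) (single_block i a b)) =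
      block_perm r id (\<lambda>i. cmat_one {1..d i}) D"
proof -
  note Q' = unitary_dagger [OF Q]
  have img': "conj_by (triples r d) (dagger Q) ` A_hat r d = A_hat r d"
    by (rule conj_by_dagger_image [OF finite_triples Q A_hat_in img])
  have S: "single_block i a b \<in> block_mats r d"
    using ab by (rule single_block_in)
  show "\<exists>D\<in>block_mats r d.
      conj_by (triples r d) (dagger Q) (block_perm r id (\<lambda>i. cmat_one {1..d i}) (single_block i a b)) =
      block_perm r id (\<lambda>i. cmat_one {1..d i}) D"
    using img' S unfolding A_hat_eq by blast
  define F where "F = block_perm r id (single_block i a b) (\<lambda>i. cmat_one {1..d i})"
  have F: "F \<in> cmats (triples r d) (triples r d)"
    unfolding F_def by (rule block_perm_in [OF id_in_Sym_A_hat S one_in_block_mats])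
  \<comment> \<open>\<open>F\<close> and the algebra act on different tensor factors.\<close>
  have comm: "F \<cdot>\<^bsub>triples r d\<^esub> A = A \<cdot>\<^bsub>triples r d\<^esub> F" if "A \<in> A_hat r d" for A
  proof -
    obtain B where B: "B \<in> block_mats r d" and A: "A = block_perm r id (\<lambda>i. cmat_one {1..d i}) B"
      using \<open>A \<in> A_hat r d\<close> by (auto simp: A_hat_eq)
    show ?thesis
      unfolding A F_def block_perm_mult [OF id_in_Sym_A_hat]
      by (rule block_perm_cong)
        (use S B in \<open>auto simp: block_mats_def cmat_one_mult cmat_mult_one simp del: atLeastAtMost_iff\<close>)
  qed
  \<comment> \<open>Every element of the algebra is itself a conjugate, so the commutation of
    \<open>F\<close> can be transported.\<close>
  have "conj_by (triples r d) (dagger Q) F \<cdot>\<^bsub>triples r d\<^esub> A =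
      A \<cdot>\<^bsub>triples r d\<^esub> conj_by (triples r d) (dagger Q) F" if A: "A \<in> A_hat r d" for A
  proof -
    have "A \<in> conj_by (triples r d) (dagger Q) ` A_hat r d"
      unfolding img' by (rule A)
    then obtain A' where A': "A' \<in> A_hat r d" "A = conj_by (triples r d) (dagger Q) A'" by blast
    note A'_in = subsetD [OF A_hat_in A'(1)]
    show ?thesis
      by (simp only: A'(2) comm [OF A'(1)] conj_by_mult [OF finite_triples Q' F A'_in, symmetric]
          conj_by_mult [OF finite_triples Q' A'_in F, symmetric])
  qed
  then show "\<exists>C\<in>block_mats r d.
      conj_by (triples r d) (dagger Q) (block_perm r id (single_block i a b) (\<lambda>i. cmat_one {1..d i})) =
      block_perm r id C (\<lambda>i. cmat_one {1..d i})"
    using commutant_A_hat [OF d conj_by_in [OF unitary_matD(1) [OF Q'] F]] by (simp add: F_def)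
qed

text \<open>
  The outer product of two columns of the block \<open>i\<close> is the image under conjugation of a
  product of matrix units, one from the commutant of the algebra and one from the algebra.
\<close>

lemma normaliser_outer_products:
  assumes d: "\<And>i. i \<in> {1..r} \<Longrightarrow> 1 \<le> d i"
    and Q: "unitary_mat (triples r d) (triples r d) Q"
    and img: "conj_by (triples r d) Q ` A_hat r d = A_hat r d"
    and i: "i \<in> {1..r}"
  obtains C D where
    "\<And>a b c e t t'. a \<in> {1..d i} \<Longrightarrow> b \<in> {1..d i} \<Longrightarrow> c \<in> {1..d i} \<Longrightarrow> e \<in> {1..d i} \<Longrightarrow>
       Q t (i, a, c) * cnj (Q t' (i, b, e)) = block_perm r id (C a b) (D c e) t t'"
proof -
  let ?J = "\<lambda>i. cmat_one {1..d i} :: (nat, nat) cmatrix"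
  have ex: "\<forall>a\<in>{1..d i}. \<forall>b\<in>{1..d i}. \<exists>C\<in>block_mats r d.
      conj_by (triples r d) (dagger Q) (block_perm r id (single_block i a b) ?J) = block_perm r id C ?J"
    "\<forall>a\<in>{1..d i}. \<forall>b\<in>{1..d i}. \<exists>D\<in>block_mats r d.
      conj_by (triples r d) (dagger Q) (block_perm r id ?J (single_block i a b)) = block_perm r id ?J D"
    using normaliser_matrix_units [OF d Q img] by blast+
  obtain C where C: "\<And>a b. a \<in> {1..d i} \<Longrightarrow> b \<in> {1..d i} \<Longrightarrow> C a b \<in> block_mats r d"
    "\<And>a b. a \<in> {1..d i} \<Longrightarrow> b \<in> {1..d i} \<Longrightarrow>
      conj_by (triples r d) (dagger Q) (block_perm r id (single_block i a b) ?J) = block_perm r id (C a b) ?J"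
    using ex(1) by metis
  obtain D where D: "\<And>a b. a \<in> {1..d i} \<Longrightarrow> b \<in> {1..d i} \<Longrightarrow> D a b \<in> block_mats r d"
    "\<And>a b. a \<in> {1..d i} \<Longrightarrow> b \<in> {1..d i} \<Longrightarrow>
      conj_by (triples r d) (dagger Q) (block_perm r id ?J (single_block i a b)) = block_perm r id ?J (D a b)"
    using ex(2) by metis
  have "Q t (i, a, c) * cnj (Q t' (i, b, e)) = block_perm r id (C a b) (D c e) t t'"
    if ab: "a \<in> {1..d i}" "b \<in> {1..d i}" and ce: "c \<in> {1..d i}" "e \<in> {1..d i}" for a b c e t t'
  proof -
    note Sab = single_block_in [of a d i b, where r = r, OF ab]
      and Sce = single_block_in [of c d i e, where r = r, OF ce]
    note Fin = block_perm_in [OF id_in_Sym_A_hat Sab one_in_block_mats]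
      and Ein = block_perm_in [OF id_in_Sym_A_hat one_in_block_mats Sce]
    have "block_perm r id (C a b) (D c e) = block_perm r id (C a b) ?J \<cdot>\<^bsub>triples r d\<^esub> block_perm r id ?J (D c e)"
      unfolding block_perm_mult [OF id_in_Sym_A_hat]
      by (rule block_perm_cong) (use C(1) [OF ab] D(1) [OF ce] in
        \<open>auto simp: block_mats_def cmat_one_mult cmat_mult_one simp del: atLeastAtMost_iff\<close>)
    also have "\<dots> = conj_by (triples r d) (dagger Q)
        (block_perm r id (single_block i a b) ?J \<cdot>\<^bsub>triples r d\<^esub> block_perm r id ?J (single_block i c e))"
      unfolding C(2) [OF ab, symmetric] D(2) [OF ce, symmetric]
      by (rule conj_by_mult [OF finite_triples unitary_dagger [OF Q] Fin Ein, symmetric])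
    also have "block_perm r id (single_block i a b) ?J \<cdot>\<^bsub>triples r d\<^esub> block_perm r id ?J (single_block i c e) =
        block_perm r id (single_block i a b) (single_block i c e)"
      unfolding block_perm_mult [OF id_in_Sym_A_hat]
      by (rule block_perm_cong) (use Sab Sce in
        \<open>auto simp: block_mats_def cmat_one_mult cmat_mult_one simp del: atLeastAtMost_iff\<close>)
    also have "\<dots> = (\<lambda>s s'. if s = (i, a, c) \<and> s' = (i, b, e) then 1 else 0)"
      using i by (auto simp: block_perm_def single_block_def fun_eq_iff)
    finally have eq: "block_perm r id (C a b) (D c e) = conj_by (triples r d) (dagger Q)
        (\<lambda>s s'. if s = (i, a, c) \<and> s' = (i, b, e) then 1 else 0)" .
    have "block_perm r id (C a b) (D c e) t t' = conj_by (triples r d) (dagger Q)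
        (\<lambda>s s'. if s = (i, a, c) \<and> s' = (i, b, e) then 1 else 0) t t'"
      by (simp only: eq)
    \<comment> \<open>Only \<open>s = (i, a, c)\<close> and \<open>s' = (i, b, e)\<close> survive,
      leaving the outer product of two columns.\<close>
    also have "\<dots> =
        (\<Sum>s\<in>triples r d. if s = (i, a, c) then Q t s * cnj (Q t' (i, b, e)) else 0)"
      unfolding conj_by_def cmat_mult_def dagger_def complex_cnj_cnj
    proof (rule sum.cong)
      fix s assume "s \<in> triples r d"
      have "(\<Sum>s'\<in>triples r d. (if s = (i, a, c) \<and> s' = (i, b, e) then 1 else 0) * cnj (Q t' s')) =
          (\<Sum>s'\<in>triples r d. if s' = (i, b, e) then (if s = (i, a, c) then cnj (Q t' (i, b, e)) else 0) else 0)"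
        by (rule sum.cong) auto
      also have "\<dots> = (if s = (i, a, c) then cnj (Q t' (i, b, e)) else 0)"
        using i ab ce by (simp add: mem_triples)
      finally show "Q t s * (\<Sum>s'\<in>triples r d. (if s = (i, a, c) \<and> s' = (i, b, e) then 1 else 0) * cnj (Q t' s')) =
          (if s = (i, a, c) then Q t s * cnj (Q t' (i, b, e)) else 0)"
        by simp
    qed simp
    also have "\<dots> = Q t (i, a, c) * cnj (Q t' (i, b, e))"
      using i ab ce by (simp add: mem_triples)
    finally show ?thesis ..
  qed
  then show thesis
    using that by blast
qed

lemma unitary_col_nonzero:
  assumes "unitary_mat I J Q" "j \<in> J"
  obtains i where "i \<in> I" "Q i j \<noteq> 0"
proof -
  have "(dagger Q \<cdot>\<^bsub>I\<^esub> Q) j j = 1"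
    using assms by (simp add: unitary_mat_def cmat_one_def)
  then have "(\<Sum>i\<in>I. dagger Q j i * Q i j) \<noteq> 0"
    by (simp add: cmat_mult_def)
  then obtain i where "i \<in> I" "dagger Q j i * Q i j \<noteq> 0"
    by (rule sum.not_neutral_contains_not_neutral)
  then show thesis using that by simp
qed

text \<open>A nonzero entry of column \<open>(i, 1, 1)\<close> serves as pivot. Dividing outer
  products by it expresses all columns of block \<open>i\<close> through tensor products supported
  in the pivot's row block. The factors are rectangular, as equality of degrees is not yet
  known.\<close>

lemma normaliser_columns:
  assumes d: "\<And>i. i \<in> {1..r} \<Longrightarrow> 1 \<le> d i"
    and Q: "unitary_mat (triples r d) (triples r d) Q"
    and img: "conj_by (triples r d) Q ` A_hat r d = A_hat r d"
    and i: "i \<in> {1..r}"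
  shows "\<exists>p\<in>{1..r}. \<exists>A\<in>cmats {1..d p} {1..d i}. \<exists>B\<in>cmats {1..d p} {1..d i}.
    \<forall>q l k b e. (q, l, k) \<in> triples r d \<longrightarrow> (i, b, e) \<in> triples r d \<longrightarrow>
      Q (q, l, k) (i, b, e) = (if q = p then A l b * B k e else 0)"
proof -
  obtain C D where CD: "\<And>a b c e t t'. a \<in> {1..d i} \<Longrightarrow> b \<in> {1..d i} \<Longrightarrow> c \<in> {1..d i} \<Longrightarrow> e \<in> {1..d i} \<Longrightarrow>
       Q t (i, a, c) * cnj (Q t' (i, b, e)) = block_perm r id (C a b) (D c e) t t'"
    using normaliser_outer_products [OF d Q img i] by metis
  have d1: "1 \<in> {1..d i}" using d [OF i] by simp
  then have "(i, 1, 1) \<in> triples r d" using i by (simp add: mem_triples)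
  then obtain t where "t \<in> triples r d" "Q t (i, 1, 1) \<noteq> 0"
    using unitary_col_nonzero [OF Q] by metis
  then obtain p l0 k0 where T: "(p, l0, k0) \<in> triples r d" and "Q (p, l0, k0) (i, 1, 1) \<noteq> 0"
    by (metis prod.collapse)
  define z where "z = cnj (Q (p, l0, k0) (i, 1, 1))"
  have z: "z \<noteq> 0" using \<open>Q (p, l0, k0) (i, 1, 1) \<noteq> 0\<close> by (simp add: z_def)
  \<comment> \<open>The outer product conjugates its second column, hence the \<open>cnj\<close>;
    the pivot scalar is put entirely into \<open>A\<close>.\<close>
  define A where "A = (\<lambda>l b. if l \<in> {1..d p} \<and> b \<in> {1..d i} then cnj (C 1 b p l0 l) / z else 0)"
  define B where "B = (\<lambda>k e. if k \<in> {1..d p} \<and> e \<in> {1..d i} then cnj (D 1 e p k0 k) else 0)"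
  have "Q (q, l, k) (i, b, e) = (if q = p then A l b * B k e else 0)"
    if "(q, l, k) \<in> triples r d" "(i, b, e) \<in> triples r d" for q l k b e
  proof -
    have "z * Q (q, l, k) (i, b, e) = cnj (block_perm r id (C 1 b) (D 1 e) (p, l0, k0) (q, l, k))"
      using CD [OF d1 _ d1, of b e "(p, l0, k0)" "(q, l, k)", symmetric] that
      by (simp add: z_def mem_triples)
    then have "Q (q, l, k) (i, b, e) = cnj (block_perm r id (C 1 b) (D 1 e) (p, l0, k0) (q, l, k)) / z"
      using z by (simp add: field_simps)
    also have "\<dots> = (if q = p then A l b * B k e else 0)"
      using that T by (auto simp: block_perm_apply A_def B_def mem_triples)
    finally show ?thesis .
  qed
  moreover have "A \<in> cmats {1..d p} {1..d i}" "B \<in> cmats {1..d p} {1..d i}"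
    by (auto simp: A_def B_def cmats_def)
  moreover have "p \<in> {1..r}" using T by (simp add: mem_triples)
  ultimately show ?thesis by blast
qed

text \<open>Fixing a diagonal position in one factor shows that the other is unitary up to a scalar;
  moving a positive scalar between the factors normalises both.\<close>

lemma unitary_kron_factors:
  fixes A :: "('i, 'j) cmatrix" and B :: "('k, 'l) cmatrix"
  assumes fin: "finite I" "finite J" "finite K" "finite L"
    and ne: "I \<noteq> {}" "J \<noteq> {}" "K \<noteq> {}" "L \<noteq> {}"
    and A: "A \<in> cmats I J" and B: "B \<in> cmats K L"
    and un: "unitary_mat (I \<times> K) (J \<times> L) (kron A B)"
  obtains M N where "unitary_mat I J M" "unitary_mat K L N" "kron M N = kron A B"
proof -
  have rows: "(A \<cdot>\<^bsub>J\<^esub> dagger A) i i' * (B \<cdot>\<^bsub>L\<^esub> dagger B) k k' = cmat_one I i i' * cmat_one K k k'"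
    if "i \<in> I" "i' \<in> I" "k \<in> K" "k' \<in> K" for i i' k k'
  proof -
    have "(A \<cdot>\<^bsub>J\<^esub> dagger A) i i' * (B \<cdot>\<^bsub>L\<^esub> dagger B) k k' =
        (kron A B \<cdot>\<^bsub>J \<times> L\<^esub> dagger (kron A B)) (i, k) (i', k')"
      by (simp add: cmat_mult_def dagger_def kron_def sum_product sum.cartesian_product
          case_prod_unfold mult_ac)
    then show ?thesis
      using that unitary_matD(2) [OF un] by (simp add: cmat_one_def)
  qed
  have cols: "(dagger A \<cdot>\<^bsub>I\<^esub> A) j j' * (dagger B \<cdot>\<^bsub>K\<^esub> B) l l' = cmat_one J j j' * cmat_one L l l'"
    if "j \<in> J" "j' \<in> J" "l \<in> L" "l' \<in> L" for j j' l l'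
  proof -
    have "(dagger A \<cdot>\<^bsub>I\<^esub> A) j j' * (dagger B \<cdot>\<^bsub>K\<^esub> B) l l' =
        (dagger (kron A B) \<cdot>\<^bsub>I \<times> K\<^esub> kron A B) (j, l) (j', l')"
      by (simp add: cmat_mult_def dagger_def kron_def sum_product sum.cartesian_product
          case_prod_unfold mult_ac)
    then show ?thesis
      using that unitary_matD(3) [OF un] by (simp add: cmat_one_def)
  qed
  obtain i0 j0 k0 l0 where in0: "i0 \<in> I" "j0 \<in> J" "k0 \<in> K" "l0 \<in> L" using ne by blast
  \<comment> \<open>The squared norm of a row of \<open>B\<close>, written as a real number so that
    its sign and root are available. Its column counterpart \<open>c'\<close> is only later shown to
    agree.\<close>
  define c where "c = (\<Sum>l\<in>L. (cmod (B k0 l))\<^sup>2)"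
  define c' where "c' = (dagger B \<cdot>\<^bsub>K\<^esub> B) l0 l0"
  have c: "(B \<cdot>\<^bsub>L\<^esub> dagger B) k0 k0 = of_real c"
    unfolding c_def of_real_sum complex_norm_square by (simp add: cmat_mult_def dagger_def)
  have AA: "of_real c * (A \<cdot>\<^bsub>J\<^esub> dagger A) i i' = cmat_one I i i'" if "i \<in> I" "i' \<in> I" for i i'
    using rows [OF that in0(3) in0(3)] in0 by (simp add: c mult.commute cmat_one_def)
  have A'A: "c' * (dagger A \<cdot>\<^bsub>I\<^esub> A) j j' = cmat_one J j j'" if "j \<in> J" "j' \<in> J" for j j'
    using cols [OF that in0(4) in0(4)] in0 by (simp add: c'_def mult.commute cmat_one_def)
  have "of_real c * (A \<cdot>\<^bsub>J\<^esub> dagger A) i0 i0 = 1"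
    using AA in0 by (simp add: cmat_one_def)
  then have "c \<noteq> 0" by auto
  moreover have "c \<ge> 0" by (simp add: c_def sum_nonneg)
  ultimately have pos: "c > 0" by simp
  \<comment> \<open>The root is real, so the adjoint leaves it unchanged.\<close>
  define s where "s = complex_of_real (sqrt c)"
  have s: "s * s = of_real c" "s \<noteq> 0" "cnj s = s"
    using pos by (simp_all add: s_def flip: of_real_mult)
  define M where "M = mat_scale s A"
  define N where "N = mat_scale (inverse s) B"
  have scale: "mat_scale x P \<cdot>\<^bsub>S\<^esub> mat_scale y R = mat_scale (x * y) (P \<cdot>\<^bsub>S\<^esub> R)"
    for x y and P :: "('x, 'y) cmatrix" and R :: "('y, 'z) cmatrix" and S
    by (simp add: mat_scale_def cmat_mult_def sum_distrib_left mult_ac)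
  have app: "mat_scale x P u v = x * P u v" for x and P :: "('x, 'y) cmatrix" and u v
    by (simp add: mat_scale_def)
  have dagger_scale: "dagger (mat_scale x P) = mat_scale (cnj x) (dagger P)"
    for x and P :: "('x, 'y) cmatrix"
    by (simp add: mat_scale_def dagger_def)
  have Min: "M \<in> cmats I J" and Nin: "N \<in> cmats K L"
    using A B by (auto simp: M_def N_def mat_scale_def cmats_def)
  have MM: "M \<cdot>\<^bsub>J\<^esub> dagger M = cmat_one I"
    by (rule cmats_eqI [OF cmat_mult_in [OF Min dagger_in [OF Min]] cmat_one_in])
      (simp add: M_def dagger_scale scale s AA app)
  have M'M: "mat_scale (c' / of_real c) (dagger M \<cdot>\<^bsub>I\<^esub> M) = cmat_one J"
  proof (rule cmats_eqI [OF _ cmat_one_in])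
    have "dagger M \<cdot>\<^bsub>I\<^esub> M \<in> cmats J J" by (rule cmat_mult_in [OF dagger_in [OF Min] Min])
    then show "mat_scale (c' / of_real c) (dagger M \<cdot>\<^bsub>I\<^esub> M) \<in> cmats J J"
      by (auto simp: cmats_def mat_scale_def)
  qed (use A'A pos in \<open>simp add: M_def dagger_scale scale s app\<close>)
  \<comment> \<open>\<open>M\<close> now has the right inverse \<open>M\<^sup>\<dagger>\<close> and a left inverse proportional to \<open>M\<^sup>\<dagger>\<close>, so the two agree.\<close>
  have "M = M \<cdot>\<^bsub>J\<^esub> mat_scale (c' / of_real c) (dagger M \<cdot>\<^bsub>I\<^esub> M)"
    by (simp add: M'M cmat_mult_one [OF fin(2) Min])
  also have "\<dots> = mat_scale 1 M \<cdot>\<^bsub>J\<^esub> mat_scale (c' / of_real c) (dagger M \<cdot>\<^bsub>I\<^esub> M)"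
    by (simp add: mat_scale_def)
  also have "\<dots> = mat_scale (c' / of_real c) ((M \<cdot>\<^bsub>J\<^esub> dagger M) \<cdot>\<^bsub>I\<^esub> M)"
    by (simp only: scale cmat_mult_assoc mult_1_left)
  also have "\<dots> = mat_scale (c' / of_real c) M"
    by (simp add: MM cmat_one_mult [OF fin(1) Min])
  finally have "M i j = c' / of_real c * M i j" for i j
    by (metis app)
  moreover have "\<exists>i j. M i j \<noteq> 0"
  proof (rule ccontr)
    assume "\<not> ?thesis"
    then have "(M \<cdot>\<^bsub>J\<^esub> dagger M) i0 i0 = 0" by (simp add: cmat_mult_def)
    then show False using in0 by (simp add: MM cmat_one_def)
  qed
  ultimately have c': "c' = of_real c"
    using pos by (force simp: field_simps)
  have uM: "unitary_mat I J M"
    using Min MM M'M pos by (simp add: unitary_mat_def c' mat_scale_def)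
  have inv_s: "inverse s * inverse s = inverse (of_real c)"
    by (metis s(1) inverse_mult_distrib)
  \<comment> \<open>With the diagonal entry of the \<open>A\<close> product known,
    \<open>rows\<close> and \<open>cols\<close> determine the products for \<open>B\<close>, and
    hence for \<open>N\<close>.\<close>
  have A1: "(A \<cdot>\<^bsub>J\<^esub> dagger A) i0 i0 = inverse (of_real c)"
    using AA [of i0 i0] in0 pos by (simp add: cmat_one_def field_simps)
  have A2: "(dagger A \<cdot>\<^bsub>I\<^esub> A) j0 j0 = inverse (of_real c)"
    using A'A [of j0 j0] in0 pos by (simp add: c' cmat_one_def field_simps)
  have NN: "N \<cdot>\<^bsub>L\<^esub> dagger N = cmat_one K"
    by (rule cmats_eqI [OF cmat_mult_in [OF Nin dagger_in [OF Nin]] cmat_one_in])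
      (use rows [OF in0(1) in0(1)] in0 in
        \<open>simp add: N_def dagger_scale scale s inv_s app A1, simp add: cmat_one_def\<close>)
  have N'N: "dagger N \<cdot>\<^bsub>K\<^esub> N = cmat_one L"
    by (rule cmats_eqI [OF cmat_mult_in [OF dagger_in [OF Nin] Nin] cmat_one_in])
      (use cols [OF in0(2) in0(2)] in0 in
        \<open>simp add: N_def dagger_scale scale s inv_s app A2, simp add: cmat_one_def\<close>)
  have "unitary_mat K L N"
    using Nin NN N'N by (simp add: unitary_mat_def)
  moreover have "kron M N = kron A B"
    using s by (auto simp: kron_def M_def N_def mat_scale_def fun_eq_iff)
  ultimately show thesis using uM that by blast
qed

lemma sum_triples_block:
  assumes "i \<in> {1..r}" and "\<And>j b e. (j, b, e) \<in> triples r d \<Longrightarrow> j \<noteq> i \<Longrightarrow> f (j, b, e) = (0 :: complex)"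
  shows "(\<Sum>t\<in>triples r d. f t) = (\<Sum>u\<in>{1..d i} \<times> {1..d i}. f (i, u))"
proof -
  have "(\<Sum>t\<in>triples r d. f t) = (\<Sum>t\<in>Pair i ` ({1..d i} \<times> {1..d i}). f t)"
  proof (rule sum.mono_neutral_right)
    show "\<forall>t\<in>triples r d - Pair i ` ({1..d i} \<times> {1..d i}). f t = 0"
    proof
      fix t assume t: "t \<in> triples r d - Pair i ` ({1..d i} \<times> {1..d i})"
      obtain j b e where "t = (j, b, e)" by (metis prod.collapse)
      with t show "f t = 0"
        by (cases "j = i") (auto simp: mem_triples intro!: assms(2))
    qed
  qed (use assms(1) in \<open>auto simp: mem_triples\<close>)
  also have "\<dots> = (\<Sum>u\<in>{1..d i} \<times> {1..d i}. f (i, u))"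
    by (subst sum.reindex) (auto simp: inj_on_def)
  finally show ?thesis .
qed

text \<open>The column analysis of \<open>Q\<close> assigns a row block to each column block; that
  of \<open>dagger Q\<close> inverts the assignment. Each selected block is then a unitary tensor
  product, and counting gives equal degrees.\<close>

lemma normaliser_A_hat:
  assumes d: "\<And>i. i \<in> {1..r} \<Longrightarrow> 1 \<le> d i"
    and Q: "unitary_mat (triples r d) (triples r d) Q"
    and img: "conj_by (triples r d) Q ` A_hat r d = A_hat r d"
  obtains \<pi> M N where "\<pi> \<in> Sym_A_hat r d"
    and "\<And>i. i \<in> {1..r} \<Longrightarrow> unitary_mat {1..d i} {1..d i} (M i)"
    and "\<And>i. i \<in> {1..r} \<Longrightarrow> unitary_mat {1..d i} {1..d i} (N i)"
    and "Q = block_perm r \<pi> M N"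
proof -
  note Q' = unitary_dagger [OF Q]
  have img': "conj_by (triples r d) (dagger Q) ` A_hat r d = A_hat r d"
    by (rule conj_by_dagger_image [OF finite_triples Q A_hat_in img])
  \<comment> \<open>The matrix is a parameter because the relation is used for both \<open>Q\<close>
    and its adjoint.\<close>
  define R where "R Q i p A B \<longleftrightarrow> p \<in> {1..r} \<and> A \<in> cmats {1..d p} {1..d i} \<and> B \<in> cmats {1..d p} {1..d i} \<and>
    (\<forall>q l k b e. (q, l, k) \<in> triples r d \<longrightarrow> (i, b, e) \<in> triples r d \<longrightarrow>
      Q (q, l, k) (i, b, e) = (if q = p then A l b * B k e else 0))"
    for Q :: "(triple, triple) cmatrix" and i p A B
  have "\<forall>i\<in>{1..r}. \<exists>p A B. R Q i p A B"
    using normaliser_columns [OF d Q img] unfolding R_def by blast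
  then obtain p A B where pAB: "\<And>i. i \<in> {1..r} \<Longrightarrow> R Q i (p i) (A i) (B i)"
    by metis
  have p: "\<And>i. i \<in> {1..r} \<Longrightarrow> p i \<in> {1..r}"
    and A: "\<And>i. i \<in> {1..r} \<Longrightarrow> A i \<in> cmats {1..d (p i)} {1..d i}"
    and B: "\<And>i. i \<in> {1..r} \<Longrightarrow> B i \<in> cmats {1..d (p i)} {1..d i}"
    and QAB: "\<And>i q l k b e. (q, l, k) \<in> triples r d \<Longrightarrow> (i, b, e) \<in> triples r d \<Longrightarrow>
      Q (q, l, k) (i, b, e) = (if q = p i then A i l b * B i k e else 0)"
    using pAB unfolding R_def mem_triples by blast+
  have "\<forall>q\<in>{1..r}. \<exists>i A B. R (dagger Q) q i A B"
    using normaliser_columns [OF d Q' img'] unfolding R_def by blast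
  then obtain p' A' B' where p'AB: "\<And>q. q \<in> {1..r} \<Longrightarrow> R (dagger Q) q (p' q) (A' q) (B' q)"
    by metis
  have p': "Q (q, l, k) (j, b, e) = 0"
    if "(q, l, k) \<in> triples r d" "(j, b, e) \<in> triples r d" "j \<noteq> p' q" for q j l k b e
  proof -
    have "R (dagger Q) q (p' q) (A' q) (B' q)"
      using p'AB that(1) by (simp add: mem_triples)
    then have "dagger Q (j, b, e) (q, l, k) = 0"
      using that unfolding R_def by simp
    then show ?thesis by (simp add: dagger_def)
  qed
  have Q_zero: "Q (q, u) (i, v) = 0"
    if "(q, u) \<in> triples r d" "(i, v) \<in> triples r d" "q \<noteq> p i" for q u i v
    using that QAB by (cases u, cases v) simp
  \<comment> \<open>A nonzero entry in column \<open>(i, 1, 1)\<close> lies in row block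
    \<open>p i\<close>, whose rows are supported in column block \<open>p' (p i)\<close>.\<close>
  have "p' (p i) = i" if i: "i \<in> {1..r}" for i
  proof -
    have s: "(i, 1, 1) \<in> triples r d" using d [OF i] i by (simp add: mem_triples)
    then obtain q l k where "(q, l, k) \<in> triples r d" "Q (q, l, k) (i, 1, 1) \<noteq> 0"
      using unitary_col_nonzero [OF Q s] by (metis prod.collapse)
    then show ?thesis using p' QAB s by metis
  qed
  then have inj: "inj_on p {1..r}" by (metis inj_onI)
  \<comment> \<open>\<open>permutes\<close> demands the identity outside
    \<open>{1..r}\<close>.\<close>
  define \<pi> where "\<pi> = (\<lambda>i. if i \<in> {1..r} then p i else i)"
  have "bij_betw p {1..r} {1..r}"
    using inj p by (simp add: bij_betw_def endo_inj_surj image_subset_iff)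
  then have "bij_betw \<pi> {1..r} {1..r}"
    using bij_betw_cong [of "{1..r}" p \<pi> "{1..r}"] by (simp add: \<pi>_def)
  then have perm: "\<pi> permutes {1..r}"
    by (rule bij_imp_permutes) (auto simp: \<pi>_def)
  have un: "unitary_mat ({1..d (p i)} \<times> {1..d (p i)}) ({1..d i} \<times> {1..d i}) (kron (A i) (B i))"
    if i: "i \<in> {1..r}" for i
  proof -
    let ?R = "{1..d (p i)} \<times> {1..d (p i)}" and ?C = "{1..d i} \<times> {1..d i}"
    have K: "kron (A i) (B i) u v = Q (p i, u) (i, v)" if "u \<in> ?R" "v \<in> ?C" for u v
      using that i p by (cases u; cases v) (auto simp: QAB mem_triples kron_def)
    have K_in: "kron (A i) (B i) \<in> cmats ?R ?C"
      using A [OF i] B [OF i] by (auto simp: cmats_def kron_def)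
    have "kron (A i) (B i) \<cdot>\<^bsub>?C\<^esub> dagger (kron (A i) (B i)) = cmat_one ?R"
    proof (rule cmats_eqI [OF cmat_mult_in [OF K_in dagger_in [OF K_in]] cmat_one_in])
      fix u u' assume u: "u \<in> ?R" "u' \<in> ?R"
      have "(kron (A i) (B i) \<cdot>\<^bsub>?C\<^esub> dagger (kron (A i) (B i))) u u' =
          (\<Sum>v\<in>?C. Q (p i, u) (i, v) * cnj (Q (p i, u') (i, v)))"
        using u unfolding cmat_mult_def dagger_def by (intro sum.cong) (simp_all only: K)
      \<comment> \<open>Injectivity of \<open>p\<close> makes the rows of block \<open>p i\<close>
        vanish outside column block \<open>i\<close>, so the sum extends to all triples and
        unitarity of \<open>Q\<close> applies.\<close>
      also have "\<dots> = (\<Sum>t\<in>triples r d. Q (p i, u) t * cnj (Q (p i, u') t))"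
      proof (rule sum_triples_block [OF i, symmetric])
        fix j b e assume j: "(j, b, e) \<in> triples r d" "j \<noteq> i"
        have "j \<in> {1..r}" using j(1) by (simp add: mem_triples)
        then have "p i \<noteq> p j" using inj_onD [OF inj _ i] j(2) by metis
        moreover have "(p i, u) \<in> triples r d" using u(1) p [OF i] unfolding triples_def by blast
        ultimately have "Q (p i, u) (j, b, e) = 0" using Q_zero j(1) by blast
        then show "Q (p i, u) (j, b, e) * cnj (Q (p i, u') (j, b, e)) = 0" by simp
      qed
      also have "\<dots> = (Q \<cdot>\<^bsub>triples r d\<^esub> dagger Q) (p i, u) (p i, u')"
        by (simp add: cmat_mult_def dagger_def)
      also have "\<dots> = cmat_one ?R u u'"
        using u p [OF i] unitary_matD(2) [OF Q] by (auto simp: cmat_one_def mem_triples)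
      finally show "(kron (A i) (B i) \<cdot>\<^bsub>?C\<^esub> dagger (kron (A i) (B i))) u u' = cmat_one ?R u u'" .
    qed
    moreover have "dagger (kron (A i) (B i)) \<cdot>\<^bsub>?R\<^esub> kron (A i) (B i) = cmat_one ?C"
    proof (rule cmats_eqI [OF cmat_mult_in [OF dagger_in [OF K_in] K_in] cmat_one_in])
      fix v v' assume v: "v \<in> ?C" "v' \<in> ?C"
      have "(dagger (kron (A i) (B i)) \<cdot>\<^bsub>?R\<^esub> kron (A i) (B i)) v v' =
          (\<Sum>u\<in>?R. cnj (Q (p i, u) (i, v)) * Q (p i, u) (i, v'))"
        using v unfolding cmat_mult_def dagger_def by (intro sum.cong) (simp_all only: K)
      also have "\<dots> = (\<Sum>t\<in>triples r d. cnj (Q t (i, v)) * Q t (i, v'))"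
      proof (rule sum_triples_block [OF p [OF i], symmetric])
        fix j b e assume j: "(j, b, e) \<in> triples r d" "j \<noteq> p i"
        moreover have "(i, v) \<in> triples r d" using v(1) i unfolding triples_def by blast
        ultimately have "Q (j, b, e) (i, v) = 0" using Q_zero by blast
        then show "cnj (Q (j, b, e) (i, v)) * Q (j, b, e) (i, v') = 0" by simp
      qed
      also have "\<dots> = (dagger Q \<cdot>\<^bsub>triples r d\<^esub> Q) (i, v) (i, v')"
        by (simp add: cmat_mult_def dagger_def)
      also have "\<dots> = cmat_one ?C v v'"
        using v i unitary_matD(3) [OF Q] by (auto simp: cmat_one_def mem_triples)
      finally show "(dagger (kron (A i) (B i)) \<cdot>\<^bsub>?R\<^esub> kron (A i) (B i)) v v' = cmat_one ?C v v'" .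
    qed
    ultimately show ?thesis using K_in by (simp add: unitary_mat_def)
  qed
  \<comment> \<open>A unitary block has as many rows as columns, so the squares of the degrees
    agree.\<close>
  have dp: "d (p i) = d i" if i: "i \<in> {1..r}" for i
  proof -
    have "d (p i) * d (p i) = d i * d i"
      using unitary_card_eq [OF _ _ un [OF i]] by (simp add: card_cartesian_product)
    then show ?thesis by (metis power2_eq_square power2_eq_imp_eq zero_le)
  qed
  have "\<forall>i\<in>{1..r}. \<exists>M N. unitary_mat {1..d i} {1..d i} M \<and> unitary_mat {1..d i} {1..d i} N \<and>
    kron M N = kron (A i) (B i)"
  proof
    fix i assume i: "i \<in> {1..r}"
    have "{1..d i} \<noteq> {}" using d [OF i] by simp
    with unitary_kron_factors [of "{1..d i}" "{1..d i}" "{1..d i}" "{1..d i}" "A i" "B i"]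
      A [OF i] B [OF i] un [OF i]
    show "\<exists>M N. unitary_mat {1..d i} {1..d i} M \<and> unitary_mat {1..d i} {1..d i} N \<and>
        kron M N = kron (A i) (B i)"
      unfolding dp [OF i] by (metis finite_atLeastAtMost)
  qed
  then obtain M N where M: "\<And>i. i \<in> {1..r} \<Longrightarrow> unitary_mat {1..d i} {1..d i} (M i)"
    and N: "\<And>i. i \<in> {1..r} \<Longrightarrow> unitary_mat {1..d i} {1..d i} (N i)"
    and MN: "\<And>i. i \<in> {1..r} \<Longrightarrow> kron (M i) (N i) = kron (A i) (B i)"
    by metis
  have sym: "\<pi> \<in> Sym_A_hat r d"
    using perm dp by (auto simp: Sym_A_hat_def \<pi>_def)
  have "M \<in> block_mats r d" "N \<in> block_mats r d"
    using M N by (auto simp: block_mats_def unitary_mat_def)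
  note in_cm = block_perm_in [OF sym this]
  have "Q = block_perm r \<pi> M N"
  proof (rule cmats_eqI [OF unitary_matD(1) [OF Q] in_cm])
    fix s t assume st: "s \<in> triples r d" "t \<in> triples r d"
    obtain q l k i b e where s: "s = (q, l, k)" and t: "t = (i, b, e)"
      by (metis prod.collapse)
    have i: "i \<in> {1..r}" using st t by (simp add: mem_triples)
    have "M i l b * N i k e = A i l b * B i k e"
      using fun_cong [OF fun_cong [OF MN [OF i], of "(l, k)"], of "(b, e)"] by (simp add: kron_def)
    then show "Q s t = block_perm r \<pi> M N s t"
      using st i by (simp add: s t QAB block_perm_apply \<pi>_def)
  qed
  then show thesis using that sym M N by blast
qed


section \<open>The coefficients of the identity element\<close>

lemma unit_coeffs_eq:
  assumes "finite (carrier G)" "\<one>\<^bsub>G\<^esub> \<in> carrier G"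
  shows "unit_coeffs G V i l k = cnj (V \<one>\<^bsub>G\<^esub> (i, l, k))"
  using assms by (simp add: unit_coeffs_def cinner_def basis_vec_def if_distrib [of "\<lambda>x. _ * x"] cong: if_cong)

lemma unit_coeffs_in:
  assumes "V \<in> cmats (carrier G) (triples r d)"
  shows "unit_coeffs G V i \<in> cmats {1..d i} {1..d i}"
proof -
  have "V x (i, l, k) = 0" if "l \<notin> {1..d i} \<or> k \<notin> {1..d i}" for x l k
    using that assms by (auto simp: cmats_def mem_triples)
  then show ?thesis by (auto simp: cmats_def unit_coeffs_def cinner_def)
qed

text \<open>This is how \<open>X\<close> and \<open>Y\<close> enter: they are the identity vectors
  in the block bases, read as families of matrices.\<close>

lemma dagger_vec_one:
  assumes "finite (carrier G)" "\<one>\<^bsub>G\<^esub> \<in> carrier G"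
  shows "cmat_vec (dagger V) (carrier G) (basis_vec \<one>\<^bsub>G\<^esub>) = (\<lambda>(i, l, k). unit_coeffs G V i l k)"
  using assms by (auto simp: unit_coeffs_eq cmat_vec_basis dagger_def fun_eq_iff)

text \<open>
  The vector \<open>e\<close> is cyclic and separating for the regular algebra, hence so is \<open>V\<^sup>\<dagger> e\<close> for
  the block algebra. Cyclicity yields a right inverse, separation shows that it is two-sided.
\<close>

lemma unit_coeffs_invertible:
  assumes G: "group G" "finite (carrier G)"
    and V: "unitary_mat (carrier G) (triples r d) V"
    and img: "conj_by (carrier G) V ` regular_algebra G = A_hat r d"
    and i: "i \<in> {1..r}"
  shows "unit_coeffs G V i \<in> Units (mat_monoid {1..d i})"
proof -
  interpret group G by fact
  note V' = unitary_matD [OF V]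
  let ?T = "triples r d" and ?J = "\<lambda>i. cmat_one {1..d i} :: (nat, nat) cmatrix"
  define X where "X = unit_coeffs G V"
  define x where "x = (\<lambda>(i, l, k). X i l k)"
  have X: "X j \<in> cmats {1..d j} {1..d j}" for j
    unfolding X_def by (rule unit_coeffs_in [OF V'(1)])
  have x: "x = cmat_vec (dagger V) (carrier G) (basis_vec \<one>\<^bsub>G\<^esub>)"
    unfolding x_def X_def using G by (simp add: dagger_vec_one)
  \<comment> \<open>\<open>V\<close> carries \<open>x\<close> back to the identity vector, where
    convolution by \<open>f\<close> returns \<open>f\<close>.\<close>
  have action: "cmat_vec (conj_by (carrier G) V (reg G f)) ?T x = cmat_vec (dagger V) (carrier G) f"
    if "f \<in> cvecs (carrier G)" for f
  proof -
    have "cmat_vec (conj_by (carrier G) V (reg G f)) ?T x = cmat_vec (dagger V) (carrier G)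
        (cmat_vec (reg G f) (carrier G) (cmat_vec (V \<cdot>\<^bsub>?T\<^esub> dagger V) (carrier G) (basis_vec \<one>\<^bsub>G\<^esub>)))"
      by (simp add: x conj_by_def cmat_vec_mult)
    then show ?thesis
      using G(2) that by (simp add: V'(2) cmat_vec_one basis_vec_in reg_vec_one)
  qed
  have surj: "\<exists>L\<in>A_hat r d. cmat_vec L ?T x = z" if z: "z \<in> cvecs ?T" for z
  proof -
    define f where "f = cmat_vec V ?T z"
    have f: "f \<in> cvecs (carrier G)" unfolding f_def by (rule cmat_vec_in [OF V'(1)])
    have "cmat_vec (conj_by (carrier G) V (reg G f)) ?T x = cmat_vec (dagger V \<cdot>\<^bsub>carrier G\<^esub> V) ?T z"
      by (simp only: action [OF f] cmat_vec_mult) (simp only: f_def)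
    also have "\<dots> = z" by (simp add: V'(3) cmat_vec_one z)
    finally show ?thesis
      using img f regular_algebra_eq [OF G(2)] by blast
  qed
  have inj: "L = K" if LK: "L \<in> A_hat r d" "K \<in> A_hat r d" and eq: "cmat_vec L ?T x = cmat_vec K ?T x" for L K
  proof -
    obtain f h where f: "f \<in> cvecs (carrier G)" "L = conj_by (carrier G) V (reg G f)"
      and h: "h \<in> cvecs (carrier G)" "K = conj_by (carrier G) V (reg G h)"
      using LK unfolding img [symmetric] regular_algebra_eq [OF G(2)] by blast
    have "cmat_vec (dagger V) (carrier G) f = cmat_vec (dagger V) (carrier G) h"
      using eq action f h by simp
    then have "cmat_vec (V \<cdot>\<^bsub>?T\<^esub> dagger V) (carrier G) f = cmat_vec (V \<cdot>\<^bsub>?T\<^esub> dagger V) (carrier G) h"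
      by (simp add: cmat_vec_mult)
    then have "f = h"
      using f h G(2) by (simp add: V'(2) cmat_vec_one)
    then show ?thesis by (simp add: f h)
  qed
  have blocks: "cmat_vec (block_perm r id ?J A) ?T x (j, l, k) = (X j \<cdot>\<^bsub>{1..d j}\<^esub> dagger (conj_mat (A j))) l k"
    if A: "A \<in> block_mats r d" and j: "j \<in> {1..r}" for A j l k
  proof -
    have "A j \<in> cmats {1..d j} {1..d j}" using A j by (simp add: block_mats_def)
    then have "X j \<cdot>\<^bsub>{1..d j}\<^esub> dagger (conj_mat (A j)) \<in> cmats {1..d j} {1..d j}"
      by (intro cmat_mult_in [OF X] dagger_in) (auto simp: conj_mat_def cmats_def)
    then show ?thesis
      using block_perm_vec [where M = ?J and N = A and Z = X and l = l and k = k, OF id_in_Sym_A_hat j]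
      by (simp add: x_def cmat_one_mult)
  qed
  \<comment> \<open>The identity matrix in block \<open>i\<close> and zero elsewhere: an algebra
    element sending \<open>x\<close> to it supplies a right inverse of \<open>X i\<close>.\<close>
  define z where "z = (\<lambda>(j, l, k). if j = i then ?J i l k else 0)"
  have "z \<in> cvecs ?T"
    using i by (auto simp: z_def cvecs_def mem_triples cmat_one_def)
  then obtain A where A: "A \<in> block_mats r d" and Az: "cmat_vec (block_perm r id ?J A) ?T x = z"
    using surj unfolding A_hat_eq by blast
  define B where "B = dagger (conj_mat (A i))"
  have B: "B \<in> cmats {1..d i} {1..d i}"
    using A i by (auto simp: B_def block_mats_def cmats_def dagger_def conj_mat_def)
  have XB: "X i \<cdot>\<^bsub>{1..d i}\<^esub> B = ?J i"
  proof (intro ext)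
    fix l k show "(X i \<cdot>\<^bsub>{1..d i}\<^esub> B) l k = ?J i l k"
      using blocks [OF A i, of l k] by (simp add: Az B_def) (simp add: z_def)
  qed
  have BX: "B \<cdot>\<^bsub>{1..d i}\<^esub> X i = ?J i"
  proof -
    \<comment> \<open>Differs from the identity only in block \<open>i\<close>, where its transpose
      is \<open>B X\<close>. As \<open>X B X = X\<close>, it acts on \<open>x\<close> like the
      identity, and separation gives \<open>B X = 1\<close>.\<close>
    define A1 where "A1 = ?J (i := conj_mat (dagger (B \<cdot>\<^bsub>{1..d i}\<^esub> X i)))"
    have BX_in: "B \<cdot>\<^bsub>{1..d i}\<^esub> X i \<in> cmats {1..d i} {1..d i}" by (rule cmat_mult_in [OF B X])
    then have A1: "A1 \<in> block_mats r d"
      using one_in_block_mats [of d r] by (auto simp: A1_def block_mats_def cmats_def dagger_def conj_mat_def)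
    have J: "dagger (conj_mat (?J j)) = ?J j" for j
      by (auto simp: dagger_def conj_mat_def cmat_one_def fun_eq_iff)
    have "X i \<cdot>\<^bsub>{1..d i}\<^esub> (B \<cdot>\<^bsub>{1..d i}\<^esub> X i) = X i"
      using XB by (simp add: cmat_mult_assoc [symmetric] cmat_one_mult [OF _ X])
    moreover have A1_i: "dagger (conj_mat (A1 i)) = B \<cdot>\<^bsub>{1..d i}\<^esub> X i"
      by (simp add: A1_def dagger_def conj_mat_def)
    ultimately have "X j \<cdot>\<^bsub>{1..d j}\<^esub> dagger (conj_mat (A1 j)) = X j \<cdot>\<^bsub>{1..d j}\<^esub> dagger (conj_mat (?J j))" for j
      by (cases "j = i") (simp_all add: J cmat_mult_one [OF _ X], simp add: A1_def J cmat_mult_one [OF _ X])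
    then have blk: "cmat_vec (block_perm r id ?J A1) ?T x (j, l, k) = cmat_vec (block_perm r id ?J ?J) ?T x (j, l, k)"
      if "j \<in> {1..r}" for j l k
      by (simp only: blocks [OF A1 that] blocks [OF one_in_block_mats that])
    have in_vecs: "cmat_vec (block_perm r id ?J C) ?T x \<in> cvecs ?T" if "C \<in> block_mats r d" for C
      by (rule cmat_vec_in [OF block_perm_in [OF id_in_Sym_A_hat one_in_block_mats that]])
    have "cmat_vec (block_perm r id ?J A1) ?T x = cmat_vec (block_perm r id ?J ?J) ?T x"
    proof
      fix t :: triple
      obtain j l k where t: "t = (j, l, k)" by (metis prod.collapse)
      show "cmat_vec (block_perm r id ?J A1) ?T x t = cmat_vec (block_perm r id ?J ?J) ?T x t"
      proof (cases "j \<in> {1..r}")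
        case True
        then show ?thesis unfolding t by (rule blk)
      next
        case False
        then have "t \<notin> ?T" by (auto simp: t mem_triples)
        then have "cmat_vec (block_perm r id ?J A1) ?T x t = 0" "cmat_vec (block_perm r id ?J ?J) ?T x t = 0"
          using in_vecs [OF A1] in_vecs [OF one_in_block_mats] unfolding cvecs_def by blast+
        then show ?thesis by simp
      qed
    qed
    then have eq: "block_perm r id ?J A1 = block_perm r id ?J ?J"
      using A1 one_in_block_mats by (intro inj) (auto simp: A_hat_eq)
    \<comment> \<open>Equal first indices \<open>k\<close> make the first tensor factor contribute
      1.\<close>
    have "A1 i = ?J i"
    proof (rule cmats_eqI)
      show "A1 i \<in> cmats {1..d i} {1..d i}" using A1 i by (simp add: block_mats_def)
      show "?J i \<in> cmats {1..d i} {1..d i}" by (rule cmat_one_in)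
      fix k k' assume "k \<in> {1..d i}" "k' \<in> {1..d i}"
      then show "A1 i k k' = ?J i k k'"
        using fun_cong [OF fun_cong [OF eq, of "(i, k, k)"], of "(i, k, k')"] i
        by (simp add: block_perm_apply cmat_one_def)
    qed
    with A1_i J [of i] show ?thesis by simp
  qed
  show ?thesis
    using XB BX X [of i] B by (auto simp: Units_def mat_monoid_def X_def)
qed

text \<open>\<open>dagger (conj_mat N)\<close> is the transpose of \<open>N\<close>, inverse to
  \<open>conj_mat N\<close> by unitarity; both right factors of \<open>M\<close> can therefore be
  cancelled.\<close>

lemma unitary_solve:
  assumes fin: "finite I" and N: "unitary_mat I I N"
    and M: "M \<in> cmats I I" and X: "X \<in> cmats I I" and Y: "Y \<in> Units (mat_monoid I)"
  shows "M \<cdot>\<^bsub>I\<^esub> (Y \<cdot>\<^bsub>I\<^esub> dagger (conj_mat N)) = X \<longleftrightarrow>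
    M = X \<cdot>\<^bsub>I\<^esub> (conj_mat N \<cdot>\<^bsub>I\<^esub> inv\<^bsub>mat_monoid I\<^esub> Y)"
proof -
  interpret monoid "mat_monoid I" by (rule monoid_mat_monoid [OF fin])
  let ?Z = "inv\<^bsub>mat_monoid I\<^esub> Y"
  note N' = unitary_matD [OF unitary_conj_mat [OF N]]
  have Yin: "Y \<in> cmats I I" and Zin: "?Z \<in> cmats I I"
    using Y Units_closed [OF Y] Units_inv_closed [OF Y] by (simp_all add: mat_monoid_def)
  have YZ: "Y \<cdot>\<^bsub>I\<^esub> ?Z = cmat_one I" and ZY: "?Z \<cdot>\<^bsub>I\<^esub> Y = cmat_one I"
    using Units_r_inv [OF Y] Units_l_inv [OF Y] by (simp_all add: mat_monoid_def)
  show ?thesis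
  proof
    assume "M \<cdot>\<^bsub>I\<^esub> (Y \<cdot>\<^bsub>I\<^esub> dagger (conj_mat N)) = X"
    then have "X \<cdot>\<^bsub>I\<^esub> (conj_mat N \<cdot>\<^bsub>I\<^esub> ?Z) = M \<cdot>\<^bsub>I\<^esub> (Y \<cdot>\<^bsub>I\<^esub> ((dagger (conj_mat N) \<cdot>\<^bsub>I\<^esub> conj_mat N) \<cdot>\<^bsub>I\<^esub> ?Z))"
      by (auto simp: cmat_mult_assoc)
    then show "M = X \<cdot>\<^bsub>I\<^esub> (conj_mat N \<cdot>\<^bsub>I\<^esub> ?Z)"
      by (simp add: N'(3) cmat_one_mult [OF fin Zin] YZ cmat_mult_one [OF fin M])
  next
    assume "M = X \<cdot>\<^bsub>I\<^esub> (conj_mat N \<cdot>\<^bsub>I\<^esub> ?Z)"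
    then have "M \<cdot>\<^bsub>I\<^esub> (Y \<cdot>\<^bsub>I\<^esub> dagger (conj_mat N)) =
        X \<cdot>\<^bsub>I\<^esub> (conj_mat N \<cdot>\<^bsub>I\<^esub> ((?Z \<cdot>\<^bsub>I\<^esub> Y) \<cdot>\<^bsub>I\<^esub> dagger (conj_mat N)))"
      by (simp add: cmat_mult_assoc)
    then show "M \<cdot>\<^bsub>I\<^esub> (Y \<cdot>\<^bsub>I\<^esub> dagger (conj_mat N)) = X"
      by (simp add: ZY cmat_one_mult [OF fin dagger_in [OF N'(1)]] N'(2) cmat_mult_one [OF fin X])
  qed
qed

text \<open>Since \<open>\<pi>\<close> is onto, its blocks reach every row block; off the triples
  both vectors vanish.\<close>

lemma block_perm_vec_eq_iff:
  assumes p: "\<pi> \<in> Sym_A_hat r d" and M: "M \<in> block_mats r d" and N: "N \<in> block_mats r d"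
    and X: "(\<lambda>(i, l, k). X i l k) \<in> cvecs (triples r d)"
  shows "cmat_vec (block_perm r \<pi> M N) (triples r d) (\<lambda>(i, l, k). Y i l k) = (\<lambda>(i, l, k). X i l k) \<longleftrightarrow>
    (\<forall>i\<in>{1..r}. M i \<cdot>\<^bsub>{1..d i}\<^esub> (Y i \<cdot>\<^bsub>{1..d i}\<^esub> dagger (conj_mat (N i))) = X (\<pi> i))"
    (is "?v = ?x \<longleftrightarrow> ?R")
proof
  assume eq: "?v = ?x"
  show ?R
  proof (intro ballI ext)
    fix i l k assume "i \<in> {1..r}"
    from block_perm_vec [OF p this, of M N Y l k]
    show "(M i \<cdot>\<^bsub>{1..d i}\<^esub> (Y i \<cdot>\<^bsub>{1..d i}\<^esub> dagger (conj_mat (N i)))) l k = X (\<pi> i) l k"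
      by (simp add: eq)
  qed
next
  assume R: ?R
  have v: "?v \<in> cvecs (triples r d)"
    by (rule cmat_vec_in [OF block_perm_in [OF p M N]])
  show "?v = ?x"
  proof
    fix t :: triple
    obtain q l k where t: "t = (q, l, k)" by (metis prod.collapse)
    show "?v t = ?x t"
    proof (cases "q \<in> {1..r}")
      case True
      then obtain i where i: "i \<in> {1..r}" "q = \<pi> i"
        using permutes_image [OF Sym_A_hatD(1) [OF p]] by (metis imageE)
      then show ?thesis
        using block_perm_vec [OF p i(1), of M N Y l k] R by (simp add: t)
    next
      case False
      then have "t \<notin> triples r d" by (auto simp: t mem_triples)
      then have "?v t = 0" "?x t = 0" using v X unfolding cvecs_def by blast+
      then show ?thesis by simp
    qed
  qed
qed

text \<open>Invertibility of \<open>Y i\<close> belongs to the conclusion because it makes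
  \<open>inv\<close> a genuine matrix inverse.\<close>

theorem theorem8p4:
  fixes G :: "('a, 'm) monoid_scheme" and G' :: "('b, 'n) monoid_scheme"
    and r :: nat and d :: "nat \<Rightarrow> nat"
    and V :: "('a, triple) cmatrix" and W :: "('b, triple) cmatrix"
    and X Y :: "nat \<Rightarrow> (nat, nat) cmatrix"
    and U :: "('a, 'b) cmatrix"
  assumes "group G" and "finite (carrier G)"
    and "group G'" and "finite (carrier G')"
    and "algebra_isomorphic (group_algebra G) (group_algebra G')"
    and "irrep_degrees G r d"
    and "unitary_mat (carrier G) (triples r d) V"
    and "unitary_mat (carrier G') (triples r d) W"
    and "(\<lambda>L. dagger V \<cdot>\<^bsub>carrier G\<^esub> (L \<cdot>\<^bsub>carrier G\<^esub> V)) ` regular_algebra G = A_hat r d"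
    and "(\<lambda>L. dagger W \<cdot>\<^bsub>carrier G'\<^esub> (L \<cdot>\<^bsub>carrier G'\<^esub> W)) ` regular_algebra G' = A_hat r d"
    and "\<And>i. i \<in> {1..r} \<Longrightarrow> X i = unit_coeffs G V i"
    and "\<And>i. i \<in> {1..r} \<Longrightarrow> Y i = unit_coeffs G' W i"
  shows "(\<forall>i\<in>{1..r}. Y i \<in> Units (mat_monoid {1..d i})) \<and>
    (transformation_matrix G G' U \<longleftrightarrow>
      (\<exists>\<pi>\<in>Sym_A_hat r d. \<exists>M N :: nat \<Rightarrow> (nat, nat) cmatrix.
         (\<forall>i\<in>{1..r}. unitary_mat {1..d i} {1..d i} (M i) \<and>
                     unitary_mat {1..d i} {1..d i} (N i) \<and>
                     M i = X (\<pi> i) \<cdot>\<^bsub>{1..d i}\<^esub>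
                             (conj_mat (N i) \<cdot>\<^bsub>{1..d i}\<^esub> inv\<^bsub>mat_monoid {1..d i}\<^esub> (Y i))) \<and>
         U = V \<cdot>\<^bsub>triples r d\<^esub>
               ((P_hat r d \<pi> \<cdot>\<^bsub>triples r d\<^esub> direct_sum r (\<lambda>i. kron (M i) (N i)))
                 \<cdot>\<^bsub>triples r d\<^esub> dagger W)))"
proof -
  interpret G: group G by fact
  interpret G': group G' by fact
  let ?T = "triples r d"
  note fin = \<open>finite (carrier G)\<close> and fin' = \<open>finite (carrier G')\<close>
  note V = \<open>unitary_mat (carrier G) ?T V\<close> and W = \<open>unitary_mat (carrier G') ?T W\<close>
  note V' = unitary_matD [OF V] and W' = unitary_matD [OF W]
  note groups = \<open>group G\<close> fin \<open>group G'\<close> fin'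
  have imgV: "conj_by (carrier G) V ` regular_algebra G = A_hat r d"
    and imgW: "conj_by (carrier G') W ` regular_algebra G' = A_hat r d"
    using assms(9,10) by (simp_all add: conj_by_def)
  have reg_sub: "regular_algebra G \<subseteq> cmats (carrier G) (carrier G)"
    "regular_algebra G' \<subseteq> cmats (carrier G') (carrier G')"
    using reg_in by (auto simp: G.regular_algebra_eq [OF fin] G'.regular_algebra_eq [OF fin'])
  note imgV' = conj_by_dagger_image [OF fin V reg_sub(1) imgV]
  note imgW' = conj_by_dagger_image [OF fin' W reg_sub(2) imgW]
  \<comment> \<open>Irreducible representations have positive degree by definition.\<close>
  have d: "1 \<le> d i" if "i \<in> {1..r}" for i
    using \<open>irrep_degrees G r d\<close> that by (auto simp: irrep_degrees_def irreducible_rep_def)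
  have Y_inv: "Y i \<in> Units (mat_monoid {1..d i})" if "i \<in> {1..r}" for i
    using unit_coeffs_invertible [OF groups(3,4) W imgW that] assms(12) [OF that] by simp
  define x where "x = (\<lambda>(i, l, k). unit_coeffs G V i l k)"
  define y where "y = (\<lambda>(i, l, k). unit_coeffs G' W i l k)"
  have x: "x = cmat_vec (dagger V) (carrier G) (basis_vec \<one>\<^bsub>G\<^esub>)"
    and y: "y = cmat_vec (dagger W) (carrier G') (basis_vec \<one>\<^bsub>G'\<^esub>)"
    by (simp_all add: x_def y_def dagger_vec_one fin fin')
  have x_in: "x \<in> cvecs ?T"
    unfolding x by (rule cmat_vec_in [OF dagger_in [OF V'(1)]])
  \<comment> \<open>The equation for \<open>M i\<close> is exactly the requirement that the identity
    vectors correspond.\<close>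
  have block_iff: "cmat_vec (block_perm r \<pi> M N) ?T y = x \<longleftrightarrow>
      (\<forall>i\<in>{1..r}. M i = X (\<pi> i) \<cdot>\<^bsub>{1..d i}\<^esub> (conj_mat (N i) \<cdot>\<^bsub>{1..d i}\<^esub> inv\<^bsub>mat_monoid {1..d i}\<^esub> (Y i)))"
    if p: "\<pi> \<in> Sym_A_hat r d"
      and M: "\<And>i. i \<in> {1..r} \<Longrightarrow> unitary_mat {1..d i} {1..d i} (M i)"
      and N: "\<And>i. i \<in> {1..r} \<Longrightarrow> unitary_mat {1..d i} {1..d i} (N i)" for \<pi> M N
  proof -
    have MN: "M \<in> block_mats r d" "N \<in> block_mats r d"
      using M N by (auto simp: block_mats_def unitary_mat_def)
    have "M i \<cdot>\<^bsub>{1..d i}\<^esub> (unit_coeffs G' W i \<cdot>\<^bsub>{1..d i}\<^esub> dagger (conj_mat (N i))) = unit_coeffs G V (\<pi> i) \<longleftrightarrow>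
        M i = X (\<pi> i) \<cdot>\<^bsub>{1..d i}\<^esub> (conj_mat (N i) \<cdot>\<^bsub>{1..d i}\<^esub> inv\<^bsub>mat_monoid {1..d i}\<^esub> (Y i))"
      if i: "i \<in> {1..r}" for i
    proof -
      have "X (\<pi> i) = unit_coeffs G V (\<pi> i)"
        using assms(11) Sym_A_hatD(2) [OF p i] .
      moreover have "unit_coeffs G V (\<pi> i) \<in> cmats {1..d i} {1..d i}"
        using unit_coeffs_in [OF V'(1), of "\<pi> i"] by (simp only: Sym_A_hatD(3) [OF p i])
      ultimately show ?thesis
        using unitary_solve [OF finite_atLeastAtMost N [OF i] unitary_matD(1) [OF M [OF i]] _ Y_inv [OF i]]
        by (simp only: assms(12) [OF i])
    qed
    then show ?thesis
      unfolding x_def y_def block_perm_vec_eq_iff [OF p MN x_in [unfolded x_def]] by (meson ball_cong)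
  qed
  have "transformation_matrix G G' U \<longleftrightarrow>
      (\<exists>\<pi>\<in>Sym_A_hat r d. \<exists>M N.
         (\<forall>i\<in>{1..r}. unitary_mat {1..d i} {1..d i} (M i) \<and> unitary_mat {1..d i} {1..d i} (N i) \<and>
            M i = X (\<pi> i) \<cdot>\<^bsub>{1..d i}\<^esub> (conj_mat (N i) \<cdot>\<^bsub>{1..d i}\<^esub> inv\<^bsub>mat_monoid {1..d i}\<^esub> (Y i))) \<and>
         U = V \<cdot>\<^bsub>?T\<^esub> ((P_hat r d \<pi> \<cdot>\<^bsub>?T\<^esub> direct_sum r (\<lambda>i. kron (M i) (N i))) \<cdot>\<^bsub>?T\<^esub> dagger W))"
    (is "_ \<longleftrightarrow> ?rhs")
  proof
    assume tm: "transformation_matrix G G' U"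
    note U_one = transformation_matrixD(1) [OF groups tm] and U_alg = transformation_matrixD(2) [OF groups tm]
    have U: "unitary_mat (carrier G) (carrier G') U"
      using tm by (simp add: transformation_matrix_def)
    note U' = unitary_matD [OF U]
    \<comment> \<open>\<open>U\<close> expressed in the bases \<open>V\<close> and
      \<open>W\<close>.\<close>
    define Q where "Q = dagger V \<cdot>\<^bsub>carrier G\<^esub> (U \<cdot>\<^bsub>carrier G'\<^esub> W)"
    have Q: "unitary_mat ?T ?T Q"
      unfolding Q_def using fin fin' U V W by (intro unitary_mult unitary_dagger) auto
    have UQ: "U = V \<cdot>\<^bsub>?T\<^esub> (Q \<cdot>\<^bsub>?T\<^esub> dagger W)"
    proof -
      have "V \<cdot>\<^bsub>?T\<^esub> (Q \<cdot>\<^bsub>?T\<^esub> dagger W) = (V \<cdot>\<^bsub>?T\<^esub> dagger V) \<cdot>\<^bsub>carrier G\<^esub> (U \<cdot>\<^bsub>carrier G'\<^esub> (W \<cdot>\<^bsub>?T\<^esub> dagger W))"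
        by (simp add: Q_def cmat_mult_assoc)
      then show ?thesis
        by (simp add: V'(2) W'(2) cmat_mult_one [OF fin' U'(1)] cmat_one_mult [OF fin U'(1)])
    qed
    \<comment> \<open>The three conjugations lead from the block algebra through both regular
      algebras and back.\<close>
    have "conj_by ?T Q ` A_hat r d =
        conj_by (carrier G') W ` conj_by (carrier G) U ` conj_by ?T (dagger V) ` A_hat r d"
      by (simp add: image_image conj_by_conj_by Q_def cmat_mult_assoc)
    then have Q_alg: "conj_by ?T Q ` A_hat r d = A_hat r d"
      by (simp only: imgV' U_alg imgW)
    have "cmat_vec Q ?T y = cmat_vec (dagger V) (carrier G) (cmat_vec U (carrier G')
        (cmat_vec (W \<cdot>\<^bsub>?T\<^esub> dagger W) (carrier G') (basis_vec \<one>\<^bsub>G'\<^esub>)))"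
      by (simp add: Q_def y cmat_vec_mult)
    then have Qy: "cmat_vec Q ?T y = x"
      by (simp add: W'(2) cmat_vec_one [OF fin'] basis_vec_in U_one x)
    obtain \<pi> M N where p: "\<pi> \<in> Sym_A_hat r d"
      and M: "\<And>i. i \<in> {1..r} \<Longrightarrow> unitary_mat {1..d i} {1..d i} (M i)"
      and N: "\<And>i. i \<in> {1..r} \<Longrightarrow> unitary_mat {1..d i} {1..d i} (N i)"
      and Qb: "Q = block_perm r \<pi> M N"
      using normaliser_A_hat [OF d Q Q_alg] by metis
    have MN: "M \<in> block_mats r d" "N \<in> block_mats r d"
      using M N by (auto simp: block_mats_def unitary_mat_def)
    show ?rhs
    proof (rule bexI [OF _ p], intro exI conjI ballI)
      show "U = V \<cdot>\<^bsub>?T\<^esub> ((P_hat r d \<pi> \<cdot>\<^bsub>?T\<^esub> direct_sum r (\<lambda>i. kron (M i) (N i))) \<cdot>\<^bsub>?T\<^esub> dagger W)"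
        unfolding P_hat_mult_direct_sum [OF MN] Qb [symmetric] by (rule UQ)
      show "M i = X (\<pi> i) \<cdot>\<^bsub>{1..d i}\<^esub> (conj_mat (N i) \<cdot>\<^bsub>{1..d i}\<^esub> inv\<^bsub>mat_monoid {1..d i}\<^esub> (Y i))"
        if "i \<in> {1..r}" for i
        using block_iff [OF p M N] Qy that unfolding Qb by blast
    qed (use M N in auto)
  next
    assume ?rhs
    then obtain \<pi> M N where p: "\<pi> \<in> Sym_A_hat r d"
      and M: "\<And>i. i \<in> {1..r} \<Longrightarrow> unitary_mat {1..d i} {1..d i} (M i)"
      and N: "\<And>i. i \<in> {1..r} \<Longrightarrow> unitary_mat {1..d i} {1..d i} (N i)"
      and eq: "\<forall>i\<in>{1..r}. M i = X (\<pi> i) \<cdot>\<^bsub>{1..d i}\<^esub> (conj_mat (N i) \<cdot>\<^bsub>{1..d i}\<^esub> inv\<^bsub>mat_monoid {1..d i}\<^esub> (Y i))"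
      and U: "U = V \<cdot>\<^bsub>?T\<^esub> ((P_hat r d \<pi> \<cdot>\<^bsub>?T\<^esub> direct_sum r (\<lambda>i. kron (M i) (N i))) \<cdot>\<^bsub>?T\<^esub> dagger W)"
      by blast
    have MN: "M \<in> block_mats r d" "N \<in> block_mats r d"
      using M N by (auto simp: block_mats_def unitary_mat_def)
    define Q where "Q = block_perm r \<pi> M N"
    have UQ: "U = V \<cdot>\<^bsub>?T\<^esub> (Q \<cdot>\<^bsub>?T\<^esub> dagger W)"
      using U by (simp only: P_hat_mult_direct_sum [OF MN] Q_def)
    have Q: "unitary_mat ?T ?T Q"
      unfolding Q_def using p M N by (rule unitary_block_perm)
    have Qy: "cmat_vec Q ?T y = x"
      using block_iff [OF p M N] eq unfolding Q_def by blast
    show "transformation_matrix G G' U"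
    proof (rule transformation_matrixI [OF groups])
      show "unitary_mat (carrier G) (carrier G') U"
        unfolding UQ using fin fin' Q V W by (intro unitary_mult unitary_dagger) auto
      have "cmat_vec U (carrier G') (basis_vec \<one>\<^bsub>G'\<^esub>) = cmat_vec V ?T (cmat_vec Q ?T y)"
        by (simp add: UQ y cmat_vec_mult)
      also have "\<dots> = cmat_vec (V \<cdot>\<^bsub>?T\<^esub> dagger V) (carrier G) (basis_vec \<one>\<^bsub>G\<^esub>)"
        unfolding Qy x by (simp add: cmat_vec_mult)
      also have "\<dots> = basis_vec \<one>\<^bsub>G\<^esub>"
        by (simp add: V'(2) cmat_vec_one [OF fin] basis_vec_in)
      finally show "cmat_vec U (carrier G') (basis_vec \<one>\<^bsub>G'\<^esub>) = basis_vec \<one>\<^bsub>G\<^esub>" .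
      \<comment> \<open>Conversely, \<open>V\<close> leads to the block algebra, \<open>Q\<close>
        maps it into itself, and \<open>dagger W\<close> leads on to the regular algebra of
        \<open>G'\<close>.\<close>
      have "conj_by (carrier G) U ` regular_algebra G =
          conj_by ?T (dagger W) ` conj_by ?T Q ` conj_by (carrier G) V ` regular_algebra G"
        by (simp add: image_image conj_by_conj_by UQ cmat_mult_assoc)
      also have "\<dots> \<subseteq> conj_by ?T (dagger W) ` A_hat r d"
        unfolding imgV Q_def by (intro image_mono conj_by_block_perm p M N)
      finally show "conj_by (carrier G) U ` regular_algebra G \<subseteq> regular_algebra G'"
        unfolding imgW' .
    qed
  qed
  with Y_inv show ?thesis by blast
qed

end
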